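(* There exist compact complex manifolds $X$ that are strongly Gauduchon but are not balanced and on which the $\partial\bar\partial$-lemma does not hold. That is, there exists a compact complex manifold $X$ such that $X$ carries a strongly Gauduchon metric, $X$ carries no balanced metric, and $X$ does not satisfy the $\partial\bar\partial$-lemma.
   Context: Let $X$ be a compact complex manifold with $\dim_{\mathbb{C}}X=n$. A Hermitian metric on $X$ is identified with its associated positive-definite $C^{\infty}$ $(1,1)$-form $\omega>0$. It is balanced if $d\omega^{n-1}=0$, and strongly Gauduchon (sG) if the $(n,n-1)$-form $\partial\omega^{n-1}$ is $\bar\partial$-exact. $X$ is called balanced (resp. strongly Gauduchon) if it carries a balanced (resp. strongly Gauduchon) metric. $X$ satisfies the $\partial\bar\partial$-lemma if for every $d$-closed form $u$ of pure type on $X$ the following are equivalent: $u$ is $d$-exact; $u$ is $\partial$-exact; $u$ is $\bar\partial$-exact; $u$ is $\partial\bar\partial$-exact. *)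

theory Defs
  imports "HOL-Analysis.Analysis"
begin

section \<open>Calculus on complex coordinate space\<close>

text \<open>
  The dimension is a natural number and not a type, so complex \<open>n\<close>-space is realised inside
  \<open>nat \<Rightarrow> complex\<close>, in the same way as \<^const>\<open>Euclidean_space\<close> is realised inside \<open>nat \<Rightarrow> real\<close>.
  The subspace topology inherited from the product topology is the Euclidean one.
\<close>

type_synonym cvec = "nat \<Rightarrow> complex"

definition Cspace :: "nat \<Rightarrow> cvec set" where
  "Cspace n = {z. \<forall>i\<ge>n. z i = 0}"

text \<open>
  Real directional derivative along the \<open>i\<close>-th complex coordinate axis: the directions
  \<open>a = 1\<close> and \<open>a = \<i>\<close> give the partial derivatives in \<open>x_i\<close> and \<open>y_i\<close>, where \<open>z_i = x_i + \<i> y_i\<close>.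
\<close>

definition pderiv_dir :: "nat \<Rightarrow> complex \<Rightarrow> (cvec \<Rightarrow> complex) \<Rightarrow> cvec \<Rightarrow> complex" where
  "pderiv_dir i a f z = vector_derivative (\<lambda>t::real. f (z(i := z i + of_real t * a))) (at 0)"

fun Ck_on :: "nat \<Rightarrow> nat \<Rightarrow> cvec set \<Rightarrow> (cvec \<Rightarrow> complex) \<Rightarrow> bool" where
  "Ck_on n 0 V f \<longleftrightarrow> continuous_on V f"
| "Ck_on n (Suc k) V f \<longleftrightarrow> continuous_on V f \<and>
     (\<forall>i<n. \<forall>a\<in>{1, \<i>}.
        (\<forall>z\<in>V. (\<lambda>t::real. f (z(i := z i + of_real t * a))) differentiable (at 0)) \<and>
        Ck_on n k V (pderiv_dir i a f))"

definition smooth_fun_on :: "nat \<Rightarrow> cvec set \<Rightarrow> (cvec \<Rightarrow> complex) \<Rightarrow> bool" where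
  "smooth_fun_on n V f \<longleftrightarrow> (\<forall>k. Ck_on n k V f)"

text \<open>The Wirtinger derivatives.\<close>

definition d_z :: "nat \<Rightarrow> (cvec \<Rightarrow> complex) \<Rightarrow> cvec \<Rightarrow> complex" where
  "d_z i f z = (pderiv_dir i 1 f z - \<i> * pderiv_dir i \<i> f z) / 2"

definition d_zbar :: "nat \<Rightarrow> (cvec \<Rightarrow> complex) \<Rightarrow> cvec \<Rightarrow> complex" where
  "d_zbar i f z = (pderiv_dir i 1 f z + \<i> * pderiv_dir i \<i> f z) / 2"

text \<open>Holomorphic in several variables: continuous, and holomorphic in each variable separately.\<close>

definition holo_fun_on :: "nat \<Rightarrow> cvec set \<Rightarrow> (cvec \<Rightarrow> complex) \<Rightarrow> bool" where
  "holo_fun_on n V f \<longleftrightarrow> continuous_on V f \<and>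
     (\<forall>z\<in>V. \<forall>i<n. (\<lambda>w. f (z(i := w))) field_differentiable (at (z i)))"

definition holo_pderiv :: "nat \<Rightarrow> (cvec \<Rightarrow> complex) \<Rightarrow> cvec \<Rightarrow> complex" where
  "holo_pderiv i f z = deriv (\<lambda>w. f (z(i := w))) (z i)"


section \<open>Complex manifolds\<close>

text \<open>
  A chart is an open set together with a coordinate map; only the values of the map on that set
  are relevant.  A manifold is given by a holomorphic atlas, which need not be maximal.
  Connectedness is not part of the definition.
\<close>

type_synonym 'a chart = "'a set \<times> ('a \<Rightarrow> cvec)"

abbreviation chart_image :: "'a chart \<Rightarrow> cvec set" where
  "chart_image c \<equiv> snd c ` fst c"

definition is_chart :: "nat \<Rightarrow> 'a topology \<Rightarrow> 'a chart \<Rightarrow> bool" where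
  "is_chart n X c \<longleftrightarrow> openin X (fst c) \<and>
     openin (top_of_set (Cspace n)) (chart_image c) \<and>
     homeomorphic_map (subtopology X (fst c)) (top_of_set (chart_image c)) (snd c)"

definition transition :: "'a chart \<Rightarrow> 'a chart \<Rightarrow> cvec \<Rightarrow> cvec" where
  "transition c c' = snd c' \<circ> inv_into (fst c) (snd c)"

definition complex_manifold :: "nat \<Rightarrow> 'a topology \<Rightarrow> 'a chart set \<Rightarrow> bool" where
  "complex_manifold n X A \<longleftrightarrow>
     Hausdorff_space X \<and> second_countable X \<and>
     (\<forall>c\<in>A. is_chart n X c) \<and> (\<Union>c\<in>A. fst c) = topspace X \<and>
     (\<forall>c\<in>A. \<forall>c'\<in>A. \<forall>j<n.
        holo_fun_on n (snd c ` (fst c \<inter> fst c')) (\<lambda>z. transition c c' z j))"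

definition compact_complex_manifold :: "nat \<Rightarrow> 'a topology \<Rightarrow> 'a chart set \<Rightarrow> bool" where
  "compact_complex_manifold n X A \<longleftrightarrow> complex_manifold n X A \<and> compact_space X"


section \<open>The exterior algebra at a point\<close>

text \<open>
  A complex covector of mixed degree is given by its coefficients: \<open>a I J\<close> is the coefficient of
  \<open>dz_I \<and> dzbar_J\<close>, where the factors of \<open>dz_I\<close> and of \<open>dzbar_J\<close> are taken in increasing order.
  In dimension \<open>n\<close> only the coefficients with \<open>I, J \<subseteq> {..<n}\<close> have a meaning; the
  others are never inspected.
\<close>

type_synonym covec = "nat set \<Rightarrow> nat set \<Rightarrow> complex"

text \<open>For disjoint \<open>A\<close> and \<open>B\<close>: \<open>dz_A \<and> dz_B = shuffle_sign A B \<cdot> dz_(A \<union> B)\<close>.\<close>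

definition shuffle_sign :: "nat set \<Rightarrow> nat set \<Rightarrow> complex" where
  "shuffle_sign A B = (-1) ^ card {(a, b). a \<in> A \<and> b \<in> B \<and> b < a}"

text \<open>
  The first sign below comes from moving \<open>dzbar_J1\<close> past \<open>dz_(I - I1)\<close>.
\<close>

definition wedge :: "covec \<Rightarrow> covec \<Rightarrow> covec" where
  "wedge a b I J = (\<Sum>I1\<in>Pow I. \<Sum>J1\<in>Pow J.
      (-1) ^ (card J1 * card (I - I1)) *
      shuffle_sign I1 (I - I1) * shuffle_sign J1 (J - J1) *
      a I1 J1 * b (I - I1) (J - J1))"

definition covec_one :: covec where
  "covec_one I J = (if I = {} \<and> J = {} then 1 else 0)"

definition wedge_power :: "covec \<Rightarrow> nat \<Rightarrow> covec" where
  "wedge_power a m = (wedge a ^^ m) covec_one"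

text \<open>The covectors \<open>\<Sum>k. a k \<cdot> dz_k\<close> and \<open>\<Sum>k. a k \<cdot> dzbar_k\<close>.\<close>

definition covec10 :: "(nat \<Rightarrow> complex) \<Rightarrow> covec" where
  "covec10 a I J = (if is_singleton I \<and> J = {} then a (the_elem I) else 0)"

definition covec01 :: "(nat \<Rightarrow> complex) \<Rightarrow> covec" where
  "covec01 a I J = (if I = {} \<and> is_singleton J then a (the_elem J) else 0)"


section \<open>Differential forms in a coordinate domain\<close>

type_synonym lform = "cvec \<Rightarrow> covec"

text \<open>Here \<open>dz_k \<and> dz_I' = shuffle_sign {k} I' \<cdot> dz_(I' \<union> {k})\<close>, and \<open>dzbar_k\<close> has to be moved past \<open>dz_I\<close>.\<close>

definition local_del :: "lform \<Rightarrow> lform" where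
  "local_del u z I J =
     (\<Sum>k\<in>I. shuffle_sign {k} (I - {k}) * d_z k (\<lambda>w. u w (I - {k}) J) z)"

definition local_delbar :: "lform \<Rightarrow> lform" where
  "local_delbar u z I J =
     (\<Sum>k\<in>J. (-1) ^ card I * shuffle_sign {k} (J - {k}) * d_zbar k (\<lambda>w. u w I (J - {k})) z)"

text \<open>
  Pullback along a holomorphic map \<open>F\<close>: each \<open>dz_i\<close> is replaced by
  \<open>dF_i = \<Sum>k. \<partial>F_i/\<partial>z_k \<cdot> dz_k\<close> and each \<open>dzbar_j\<close> by the conjugate of \<open>dF_j\<close>.
\<close>

definition pullback :: "nat \<Rightarrow> (cvec \<Rightarrow> cvec) \<Rightarrow> lform \<Rightarrow> lform" where
  "pullback n F u z K L =
     (\<Sum>I\<in>Pow {..<n}. \<Sum>J\<in>Pow {..<n}. u (F z) I J *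
        foldr wedge
          (map (\<lambda>i. covec10 (\<lambda>k. holo_pderiv k (\<lambda>w. F w i) z)) (sorted_list_of_set I) @
           map (\<lambda>j. covec01 (\<lambda>k. cnj (holo_pderiv k (\<lambda>w. F w j) z))) (sorted_list_of_set J))
          covec_one K L)"


section \<open>Differential forms on a manifold\<close>

text \<open>
  A form on a manifold is a family of local forms, one for each chart of the atlas, which agree
  under pullback along the transition maps.  Only the values on the image of the chart matter, so
  equality of forms is \<open>form_eq\<close>.  Forms are complex valued and may be of mixed degree.
\<close>

type_synonym 'a form = "'a chart \<Rightarrow> lform"

definition smooth_form :: "nat \<Rightarrow> 'a chart set \<Rightarrow> 'a form \<Rightarrow> bool" where
  "smooth_form n A u \<longleftrightarrow>
     (\<forall>c\<in>A. \<forall>I\<subseteq>{..<n}. \<forall>J\<subseteq>{..<n}. smooth_fun_on n (chart_image c) (\<lambda>z. u c z I J)) \<and>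
     (\<forall>c\<in>A. \<forall>c'\<in>A. \<forall>z \<in> snd c ` (fst c \<inter> fst c'). \<forall>K\<subseteq>{..<n}. \<forall>L\<subseteq>{..<n}.
        u c z K L = pullback n (transition c c') (u c') z K L)"

definition form_eq :: "nat \<Rightarrow> 'a chart set \<Rightarrow> 'a form \<Rightarrow> 'a form \<Rightarrow> bool" where
  "form_eq n A u v \<longleftrightarrow>
     (\<forall>c\<in>A. \<forall>z\<in>chart_image c. \<forall>I\<subseteq>{..<n}. \<forall>J\<subseteq>{..<n}. u c z I J = v c z I J)"

definition form_zero :: "'a form" where
  "form_zero c z I J = 0"

definition pure_type :: "nat \<Rightarrow> 'a chart set \<Rightarrow> nat \<Rightarrow> nat \<Rightarrow> 'a form \<Rightarrow> bool" where
  "pure_type n A p q u \<longleftrightarrow>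
     (\<forall>c\<in>A. \<forall>z\<in>chart_image c. \<forall>I\<subseteq>{..<n}. \<forall>J\<subseteq>{..<n}.
        \<not> (card I = p \<and> card J = q) \<longrightarrow> u c z I J = 0)"

definition del :: "'a form \<Rightarrow> 'a form" where
  "del u c = local_del (u c)"

definition delbar :: "'a form \<Rightarrow> 'a form" where
  "delbar u c = local_delbar (u c)"

definition ext_d :: "'a form \<Rightarrow> 'a form" where
  "ext_d u c z I J = del u c z I J + delbar u c z I J"

definition form_power :: "'a form \<Rightarrow> nat \<Rightarrow> 'a form" where
  "form_power u m c z = wedge_power (u c z) m"

definition d_closed :: "nat \<Rightarrow> 'a chart set \<Rightarrow> 'a form \<Rightarrow> bool" where
  "d_closed n A u \<longleftrightarrow> form_eq n A (ext_d u) form_zero"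

text \<open>
  Exactness means lying in the image of the operator on the algebra of all smooth forms.  As the
  operators are graded, the primitive of a form of pure type can always be replaced by its component of
  the appropriate degree.
\<close>

definition d_exact :: "nat \<Rightarrow> 'a chart set \<Rightarrow> 'a form \<Rightarrow> bool" where
  "d_exact n A u \<longleftrightarrow> (\<exists>v. smooth_form n A v \<and> form_eq n A u (ext_d v))"

definition del_exact :: "nat \<Rightarrow> 'a chart set \<Rightarrow> 'a form \<Rightarrow> bool" where
  "del_exact n A u \<longleftrightarrow> (\<exists>v. smooth_form n A v \<and> form_eq n A u (del v))"

definition delbar_exact :: "nat \<Rightarrow> 'a chart set \<Rightarrow> 'a form \<Rightarrow> bool" where
  "delbar_exact n A u \<longleftrightarrow> (\<exists>v. smooth_form n A v \<and> form_eq n A u (delbar v))"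

definition del_delbar_exact :: "nat \<Rightarrow> 'a chart set \<Rightarrow> 'a form \<Rightarrow> bool" where
  "del_delbar_exact n A u \<longleftrightarrow> (\<exists>v. smooth_form n A v \<and> form_eq n A u (del (delbar v)))"


section \<open>Hermitian metrics and the del-delbar lemma\<close>

definition pos_def_hermitian :: "nat \<Rightarrow> (nat \<Rightarrow> nat \<Rightarrow> complex) \<Rightarrow> bool" where
  "pos_def_hermitian n h \<longleftrightarrow>
     (\<forall>j<n. \<forall>k<n. h k j = cnj (h j k)) \<and>
     (\<forall>v. (\<exists>j<n. v j \<noteq> 0) \<longrightarrow> 0 < Re (\<Sum>j<n. \<Sum>k<n. h j k * v j * cnj (v k)))"

text \<open>
  A metric is identified with its \<open>(1,1)\<close>-form \<open>\<omega> = \<i> \<Sum>j k. h j k \<cdot> dz_j \<and> dzbar_k\<close>, so that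
  \<open>h j k = - \<i> \<cdot> \<omega> {j} {k}\<close>.
\<close>

definition hermitian_metric :: "nat \<Rightarrow> 'a chart set \<Rightarrow> 'a form \<Rightarrow> bool" where
  "hermitian_metric n A \<omega> \<longleftrightarrow> smooth_form n A \<omega> \<and> pure_type n A 1 1 \<omega> \<and>
     (\<forall>c\<in>A. \<forall>z\<in>chart_image c. pos_def_hermitian n (\<lambda>j k. - \<i> * \<omega> c z {j} {k}))"

definition balanced_metric :: "nat \<Rightarrow> 'a chart set \<Rightarrow> 'a form \<Rightarrow> bool" where
  "balanced_metric n A \<omega> \<longleftrightarrow> hermitian_metric n A \<omega> \<and> d_closed n A (form_power \<omega> (n - 1))"

definition sG_metric :: "nat \<Rightarrow> 'a chart set \<Rightarrow> 'a form \<Rightarrow> bool" where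
  "sG_metric n A \<omega> \<longleftrightarrow> hermitian_metric n A \<omega> \<and> delbar_exact n A (del (form_power \<omega> (n - 1)))"

definition balanced_manifold :: "nat \<Rightarrow> 'a chart set \<Rightarrow> bool" where
  "balanced_manifold n A \<longleftrightarrow> (\<exists>\<omega>. balanced_metric n A \<omega>)"

definition strongly_Gauduchon_manifold :: "nat \<Rightarrow> 'a chart set \<Rightarrow> bool" where
  "strongly_Gauduchon_manifold n A \<longleftrightarrow> (\<exists>\<omega>. sG_metric n A \<omega>)"

definition satisfies_del_delbar_lemma :: "nat \<Rightarrow> 'a chart set \<Rightarrow> bool" where
  "satisfies_del_delbar_lemma n A \<longleftrightarrow>
     (\<forall>u p q. smooth_form n A u \<and> pure_type n A p q u \<and> d_closed n A u \<longrightarrow>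
        (d_exact n A u \<longleftrightarrow> del_exact n A u) \<and>
        (del_exact n A u \<longleftrightarrow> delbar_exact n A u) \<and>
        (delbar_exact n A u \<longleftrightarrow> del_delbar_exact n A u))"

text \<open>
  Existence of a manifold has to refer to a type of points.  A second countable manifold has at
  most continuum many points, so up to isomorphism every complex manifold has its points in
  \<open>manifold_point\<close>.
\<close>

type_synonym manifold_point = "nat \<Rightarrow> complex"

end

theory Submission
  imports Defs
begin

text \<open>
  The manifold is the quotient of complex 3-space by the discrete group of affine maps
  \<open>(z_0, z_1, z_2) \<mapsto> (z_0 + a, z_1 + b, z_2 + g - a z_1 + cnj a z_0)\<close> with Gaussian integers \<open>a, b, g\<close>.
  The forms \<open>dz_0\<close>, \<open>dz_1\<close> and \<open>\<phi> = dz_2 + z_0 dz_1 - cnj z_0 dz_0\<close> are invariant, and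
  \<open>d\<phi> = dz_0 \<and> dz_1 + dz_0 \<and> dzbar_0\<close>.

  The metric for which this coframe is unitary is strongly Gauduchon: the form \<open>del (\<omega> \<and> \<omega>)\<close> is a multiple
  of \<open>dz_0 \<and> dz_1 \<and> dz_2 \<and> dzbar_0 \<and> dzbar_1\<close>, which is \<open>delbar (dz_0 \<and> dz_1 \<and> dz_2 \<and> cnj \<phi>)\<close> up to sign.
  The form \<open>dz_0 \<and> dz_1 = del \<phi>\<close> has type \<open>(2,0)\<close>, so it is not \<open>delbar\<close>-exact, and the
  del-delbar lemma fails.  If \<open>\<omega>\<close> were balanced, then \<open>delbar (\<phi> \<and> \<omega> \<and> \<omega>)\<close> would be, up to
  a constant phase, \<open>dz_0 \<and> dzbar_0 \<and> \<omega> \<and> \<omega>\<close>, a strictly positive volume form, which Stokes' theorem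
  forbids.  Here Stokes' theorem is proved by averaging over the unit cube, a fundamental domain.
\<close>

section \<open>Partial derivatives\<close>

text \<open>The structure equation comes from two duality criteria. A compact manifold is balanced
  iff no nonzero positive (1,1)-current is the (1,1)-part of an exact current, and strongly
  Gauduchon iff no such current is itself d-exact. Here \<i> dz_0 \<and> dzbar_0 is the (1,1)-part
  of d(\<i> \<phi>), which rules out balanced metrics, while the (2,0)-part dz_0 \<and> dz_1 keeps
  d(\<i> \<phi>) from being of type (1,1) and leaves room for a strongly Gauduchon metric. The
  criteria are only motivation; both claims are checked directly.

  The obstacle is that a hypothetical balanced metric need not be invariant, so linear algebra on
  the coframe is not enough. Its coefficients are lifted to functions on 3-space and integrated over
  the cube. Opposite faces in the directions of z_1 and z_2 match by plain translation, but a step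
  in z_0 also shears z_2. Those two face terms cancel only after averaging over the z_2-torus, which
  does not see the shear.\<close>

definition has_pderiv :: "(cvec \<Rightarrow> complex) \<Rightarrow> nat \<Rightarrow> complex \<Rightarrow> cvec \<Rightarrow> complex \<Rightarrow> bool" where
  "has_pderiv f i a z D \<longleftrightarrow>
     ((\<lambda>t::real. f (z(i := z i + of_real t * a))) has_vector_derivative D) (at 0)"

lemma has_pderiv_imp_pderiv_dir: "has_pderiv f i a z D \<Longrightarrow> pderiv_dir i a f z = D"
  unfolding has_pderiv_def pderiv_dir_def by (rule vector_derivative_at)

lemma has_pderiv_pderiv_dir:
  assumes "(\<lambda>t::real. f (z(i := z i + of_real t * a))) differentiable (at 0)"
  shows "has_pderiv f i a z (pderiv_dir i a f z)"
  using assms unfolding has_pderiv_def pderiv_dir_def by (simp add: vector_derivative_works)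

lemma has_pderiv_imp_differentiable:
  "has_pderiv f i a z D \<Longrightarrow> (\<lambda>t::real. f (z(i := z i + of_real t * a))) differentiable (at 0)"
  unfolding has_pderiv_def by (rule differentiableI_vector)

lemma has_pderiv_const: "has_pderiv (\<lambda>z. c) i a z 0"
  unfolding has_pderiv_def by simp

lemma has_pderiv_coord: "has_pderiv (\<lambda>z. z j) i a z (if j = i then a else 0)"
proof (cases "j = i")
  case True
  have "((\<lambda>t::real. z i + of_real t * a) has_vector_derivative a) (at 0)"
    by (auto intro!: derivative_eq_intros simp: scaleR_conv_of_real)
  then show ?thesis using True by (simp add: has_pderiv_def)
qed (simp add: has_pderiv_def)

lemma has_pderiv_cnj:
  assumes "has_pderiv f i a z D"
  shows "has_pderiv (\<lambda>z. cnj (f z)) i a z (cnj D)"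
  using assms unfolding has_pderiv_def by (rule has_vector_derivative_cnj)

lemma has_pderiv_add:
  assumes "has_pderiv f i a z D" "has_pderiv g i a z E"
  shows "has_pderiv (\<lambda>z. f z + g z) i a z (D + E)"
  using assms unfolding has_pderiv_def by (rule has_vector_derivative_add)

lemma has_pderiv_diff:
  assumes "has_pderiv f i a z D" "has_pderiv g i a z E"
  shows "has_pderiv (\<lambda>z. f z - g z) i a z (D - E)"
  using assms unfolding has_pderiv_def by (rule has_vector_derivative_diff)

lemma has_pderiv_mult:
  assumes "has_pderiv f i a z D" "has_pderiv g i a z E"
  shows "has_pderiv (\<lambda>z. f z * g z) i a z (f z * E + D * g z)"
  using has_vector_derivative_mult[OF assms[unfolded has_pderiv_def]] by (simp add: has_pderiv_def)

text \<open>Translating the parameter moves the derivative from parameter 0 to any point of the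
  line, the form needed by the fundamental theorem of calculus.\<close>

lemma has_pderiv_line:
  assumes "has_pderiv f i a (z(i := z i + of_real t * a)) D"
  shows "((\<lambda>t::real. f (z(i := z i + of_real t * a))) has_vector_derivative D) (at t)"
proof -
  \<comment> \<open>The base point is written \<open>t - t\<close> to fit the chain rule with inner
    map \<open>s - t\<close>.\<close>
  have shifted: "((\<lambda>s::real. f (z(i := z i + of_real (s + t) * a))) has_vector_derivative D) (at (t - t))"
    using assms by (simp add: has_pderiv_def algebra_simps)
  have "((\<lambda>s. s - t) has_vector_derivative 1) (at t)"
    by (auto intro!: derivative_eq_intros)
  from vector_diff_chain_at[OF this shifted] show ?thesis
    by (simp only: o_def diff_add_cancel scaleR_one)
qed

section \<open>Locality of partial derivatives and Wirtinger derivatives of coordinates\<close>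

lemma Cspace_upd: "z \<in> Cspace n \<Longrightarrow> i < n \<Longrightarrow> z(i := w) \<in> Cspace n"
  by (auto simp: Cspace_def)

lemma continuous_on_upd [continuous_intros]:
  fixes f :: "'a::topological_space \<Rightarrow> cvec"
  assumes "continuous_on S f" "continuous_on S g"
  shows "continuous_on S (\<lambda>x. (f x)(i := g x))"
proof (rule continuous_on_coordinatewise_then_product)
  fix j
  show "continuous_on S (\<lambda>x. ((f x)(i := g x)) j)"
    by (cases "j = i") (use assms in \<open>auto intro: continuous_on_product_then_coordinatewise\<close>)
qed

text \<open>Chart images are open only relative to \<open>Cspace n\<close>. Changing a coordinate
  below \<open>n\<close> stays in \<open>Cspace n\<close>, so relative openness still gives a true
  neighbourhood in that coordinate.\<close>

lemma eventually_upd_mem: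
  assumes "openin (top_of_set (Cspace n)) N" "z \<in> N" "i < n"
  shows "\<forall>\<^sub>F w in nhds (z i). z(i := w) \<in> N"
proof -
  obtain T where T: "open T" "N = Cspace n \<inter> T"
    using assms(1) by (auto simp: openin_open)
  have "open ((\<lambda>w. z(i := w)) -` T)"
    by (rule open_vimage[OF T(1)]) (intro continuous_intros)
  moreover have "z i \<in> (\<lambda>w. z(i := w)) -` T"
    using assms(2) T by simp
  moreover have "z(i := w) \<in> N" if "w \<in> (\<lambda>w. z(i := w)) -` T" for w
    using that T(2) assms(2,3) by (auto intro: Cspace_upd)
  ultimately show ?thesis
    unfolding eventually_nhds by blast
qed

lemma eventually_line_mem:
  assumes "openin (top_of_set (Cspace n)) N" "z \<in> N" "i < n"
  shows "\<forall>\<^sub>F t in nhds (0::real). z(i := z i + of_real t * a) \<in> N"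
proof -
  have "((\<lambda>t::real. z i + of_real t * a) \<longlongrightarrow> z i + of_real 0 * a) (nhds 0)"
    by (intro tendsto_intros filterlim_ident)
  then show ?thesis
    using eventually_compose_filterlim[OF eventually_upd_mem[OF assms]] by simp
qed

lemma has_pderiv_cong:
  assumes "openin (top_of_set (Cspace n)) N" "z \<in> N" "i < n" "\<And>w. w \<in> N \<Longrightarrow> f w = g w"
  shows "has_pderiv f i a z D \<longleftrightarrow> has_pderiv g i a z D"
  unfolding has_pderiv_def
proof (rule has_vector_derivative_cong_ev)
  show "\<forall>\<^sub>F t in nhds (0::real). t \<in> UNIV \<longrightarrow>
      f (z(i := z i + of_real t * a)) = g (z(i := z i + of_real t * a))"
    using eventually_line_mem[OF assms(1-3), of a] by eventually_elim (simp add: assms(4))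
qed (use assms in simp)

lemma pderiv_dir_cong:
  assumes "openin (top_of_set (Cspace n)) N" "z \<in> N" "i < n" "\<And>w. w \<in> N \<Longrightarrow> f w = g w"
  shows "pderiv_dir i a f z = pderiv_dir i a g z"
proof -
  have "has_pderiv f i a z = has_pderiv g i a z"
    by (rule ext, rule has_pderiv_cong) (fact assms)+
  then show ?thesis
    unfolding pderiv_dir_def vector_derivative_def by (simp add: has_pderiv_def fun_eq_iff)
qed

lemma d_z_cong:
  assumes "openin (top_of_set (Cspace n)) N" "z \<in> N" "i < n" "\<And>w. w \<in> N \<Longrightarrow> f w = g w"
  shows "d_z i f z = d_z i g z"
  using pderiv_dir_cong[OF assms] by (simp add: d_z_def)

lemma d_zbar_cong:
  assumes "openin (top_of_set (Cspace n)) N" "z \<in> N" "i < n" "\<And>w. w \<in> N \<Longrightarrow> f w = g w"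
  shows "d_zbar i f z = d_zbar i g z"
  using pderiv_dir_cong[OF assms] by (simp add: d_zbar_def)

lemma d_z_eqI:
  "has_pderiv f i 1 z D \<Longrightarrow> has_pderiv f i \<i> z E \<Longrightarrow> d_z i f z = (D - \<i> * E) / 2"
  by (simp add: d_z_def has_pderiv_imp_pderiv_dir)

lemma d_zbar_eqI:
  "has_pderiv f i 1 z D \<Longrightarrow> has_pderiv f i \<i> z E \<Longrightarrow> d_zbar i f z = (D + \<i> * E) / 2"
  by (simp add: d_zbar_def has_pderiv_imp_pderiv_dir)

lemma d_z_const [simp]: "d_z i (\<lambda>z. c) z = 0"
  and d_zbar_const [simp]: "d_zbar i (\<lambda>z. c) z = 0"
  by (simp_all add: d_z_eqI[OF has_pderiv_const has_pderiv_const]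
      d_zbar_eqI[OF has_pderiv_const has_pderiv_const])

lemma d_z_coord [simp]: "d_z i (\<lambda>z. z j) z = (if j = i then 1 else 0)"
  and d_zbar_coord [simp]: "d_zbar i (\<lambda>z. z j) z = 0"
  by (simp_all add: d_z_eqI[OF has_pderiv_coord has_pderiv_coord]
      d_zbar_eqI[OF has_pderiv_coord has_pderiv_coord])

lemma d_z_cnj_coord [simp]: "d_z i (\<lambda>z. cnj (z j)) z = 0"
  and d_zbar_cnj_coord [simp]: "d_zbar i (\<lambda>z. cnj (z j)) z = (if j = i then 1 else 0)"
  by (simp_all add: d_z_eqI[OF has_pderiv_cnj[OF has_pderiv_coord] has_pderiv_cnj[OF has_pderiv_coord]]
      d_zbar_eqI[OF has_pderiv_cnj[OF has_pderiv_coord] has_pderiv_cnj[OF has_pderiv_coord]])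

lemma has_pderiv_cmult:
  "has_pderiv f i a z D \<Longrightarrow> has_pderiv (\<lambda>z. c * f z) i a z (c * D)"
  using has_pderiv_mult[OF has_pderiv_const] by fastforce

lemma d_z_indep:
  assumes "\<And>w c. f (w(k := c)) = f w"
  shows "d_z k f z = 0" "d_zbar k f z = 0"
  by (simp_all add: d_z_def d_zbar_def pderiv_dir_def assms)

lemma ii_sandwich: "\<i> * (c * \<i>) = - c"
  by (simp add: complex_eq_iff)

lemma d_z_cmult_coord [simp]: "d_z i (\<lambda>z. c * z j) z = (if j = i then c else 0)"
  by (simp add: d_z_eqI[OF has_pderiv_cmult[OF has_pderiv_coord] has_pderiv_cmult[OF has_pderiv_coord]]
      ii_sandwich)

lemma d_zbar_cmult_coord [simp]: "d_zbar i (\<lambda>z. c * z j) z = 0"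
  by (simp add: d_zbar_eqI[OF has_pderiv_cmult[OF has_pderiv_coord] has_pderiv_cmult[OF has_pderiv_coord]]
      ii_sandwich)

lemma d_zbar_cmult_cnj_coord [simp]: "d_zbar i (\<lambda>z. c * cnj (z j)) z = (if j = i then c else 0)"
  by (simp add: d_zbar_eqI[OF has_pderiv_cmult[OF has_pderiv_cnj[OF has_pderiv_coord]]
        has_pderiv_cmult[OF has_pderiv_cnj[OF has_pderiv_coord]]] ii_sandwich)

lemma d_zbar_uminus_cmult_coord [simp]:
  "d_zbar i (\<lambda>z. - (c * cnj (z j))) z = (if j = i then - c else 0)"
  using d_zbar_cmult_cnj_coord[of i "- c" j z] by simp

section \<open>Polynomials in the coordinates and their conjugates\<close>

inductive_set real_polys :: "(cvec \<Rightarrow> complex) set" where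
  const: "(\<lambda>z. c) \<in> real_polys"
| coord: "(\<lambda>z. z j) \<in> real_polys"
| cnj_coord: "(\<lambda>z. cnj (z j)) \<in> real_polys"
| add: "f \<in> real_polys \<Longrightarrow> g \<in> real_polys \<Longrightarrow> (\<lambda>z. f z + g z) \<in> real_polys"
| mult: "f \<in> real_polys \<Longrightarrow> g \<in> real_polys \<Longrightarrow> (\<lambda>z. f z * g z) \<in> real_polys"

lemma real_polys_uminus: "f \<in> real_polys \<Longrightarrow> (\<lambda>z. - f z) \<in> real_polys"
  using real_polys.mult[OF real_polys.const[of "-1"], of f] by simp

lemma real_polys_continuous: "f \<in> real_polys \<Longrightarrow> continuous_on S f"
proof (induction rule: real_polys.induct)
  case (coord j)
  show ?case by (rule continuous_on_product_then_coordinatewise[OF continuous_on_id])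
next
  case (cnj_coord j)
  show ?case
    by (intro continuous_intros continuous_on_product_then_coordinatewise[OF continuous_on_id])
qed (auto intro!: continuous_intros)

text \<open>This closure under differentiation is the reason for the class: smoothness of every
  order then follows by induction on the order.\<close>

lemma real_polys_has_pderiv:
  "f \<in> real_polys \<Longrightarrow> \<exists>g\<in>real_polys. \<forall>z. has_pderiv f i a z (g z)"
proof (induction rule: real_polys.induct)
  case (const c)
  show ?case by (rule bexI[OF _ real_polys.const[of 0]]) (simp add: has_pderiv_const)
next
  case (coord j)
  show ?case by (rule bexI[OF _ real_polys.const[of "if j = i then a else 0"]]) (use has_pderiv_coord in blast)
next
  case (cnj_coord j)
  show ?case by (rule bexI[OF _ real_polys.const[of "cnj (if j = i then a else 0)"]])
      (use has_pderiv_cnj[OF has_pderiv_coord] in blast)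
next
  case (add f g)
  then obtain f' g' where "f' \<in> real_polys" "g' \<in> real_polys"
    "\<forall>z. has_pderiv f i a z (f' z)" "\<forall>z. has_pderiv g i a z (g' z)" by blast
  then show ?case
    by (intro bexI[of _ "\<lambda>z. f' z + g' z"]) (auto intro: has_pderiv_add real_polys.add)
next
  case (mult f g)
  then obtain f' g' where "f' \<in> real_polys" "g' \<in> real_polys"
    "\<forall>z. has_pderiv f i a z (f' z)" "\<forall>z. has_pderiv g i a z (g' z)" by blast
  then show ?case using mult
    by (intro bexI[of _ "\<lambda>z. f z * g' z + f' z * g z"])
      (auto intro: has_pderiv_mult real_polys.add real_polys.mult)
qed

lemma real_polys_cnj: "f \<in> real_polys \<Longrightarrow> (\<lambda>z. cnj (f z)) \<in> real_polys"
proof (induction rule: real_polys.induct)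
  case (const c)
  show ?case by (rule real_polys.const)
next
  case (coord j)
  show ?case by (rule real_polys.cnj_coord)
next
  case (cnj_coord j)
  show ?case by (simp add: real_polys.coord)
qed (auto intro: real_polys.add real_polys.mult)

lemma real_polys_sum:
  "(\<And>i. i \<in> A \<Longrightarrow> f i \<in> real_polys) \<Longrightarrow> (\<lambda>z. \<Sum>i\<in>A. f i z) \<in> real_polys"
  by (induction A rule: infinite_finite_induct) (auto intro: real_polys.const real_polys.add)

lemma real_polys_smooth:
  assumes "f \<in> real_polys"
  shows "smooth_fun_on n V f"
  unfolding smooth_fun_on_def
proof
  fix k
  show "Ck_on n k V f"
    using assms
  proof (induction k arbitrary: f)
    case 0
    then show ?case by (simp add: real_polys_continuous)
  next
    case (Suc k)
    have "(\<forall>z\<in>V. (\<lambda>t::real. f (z(i := z i + of_real t * a))) differentiable (at 0)) \<and>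
        Ck_on n k V (pderiv_dir i a f)" for i a
    proof -
      obtain g where g: "g \<in> real_polys" "\<And>z. has_pderiv f i a z (g z)"
        using real_polys_has_pderiv[OF Suc.prems] by blast
      then have "pderiv_dir i a f = g"
        using has_pderiv_imp_pderiv_dir by blast
      then show ?thesis
        using g Suc.IH has_pderiv_imp_differentiable by blast
    qed
    then show ?case
      using real_polys_continuous[OF Suc.prems] by simp
  qed
qed

section \<open>Continuously differentiable functions on the whole space\<close>

definition C1_fun :: "nat \<Rightarrow> (cvec \<Rightarrow> complex) \<Rightarrow> bool" where
  "C1_fun n f \<longleftrightarrow> continuous_on (Cspace n) f \<and>
     (\<forall>i<n. \<forall>a\<in>{1, \<i>}. continuous_on (Cspace n) (pderiv_dir i a f) \<and>
       (\<forall>z\<in>Cspace n. has_pderiv f i a z (pderiv_dir i a f z)))"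

lemma C1_funD:
  assumes "C1_fun n f"
  shows "continuous_on (Cspace n) f"
    and "i < n \<Longrightarrow> a \<in> {1, \<i>} \<Longrightarrow> continuous_on (Cspace n) (pderiv_dir i a f)"
    and "i < n \<Longrightarrow> a \<in> {1, \<i>} \<Longrightarrow> z \<in> Cspace n \<Longrightarrow> has_pderiv f i a z (pderiv_dir i a f z)"
  using assms unfolding C1_fun_def by blast+

lemma C1_funI:
  assumes "continuous_on (Cspace n) f"
    and "\<And>i a. i < n \<Longrightarrow> a \<in> {1, \<i>} \<Longrightarrow> continuous_on (Cspace n) (f' i a)"
    and "\<And>i a z. i < n \<Longrightarrow> a \<in> {1, \<i>} \<Longrightarrow> z \<in> Cspace n \<Longrightarrow> has_pderiv f i a z (f' i a z)"
  shows "C1_fun n f"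
  unfolding C1_fun_def
proof (intro conjI allI ballI impI)
  fix i a assume i: "i < n" "a \<in> {1, \<i>}"
  have eq: "pderiv_dir i a f z = f' i a z" if "z \<in> Cspace n" for z
    using has_pderiv_imp_pderiv_dir[OF assms(3)[OF i that]] .
  show "continuous_on (Cspace n) (pderiv_dir i a f)"
    using assms(2)[OF i] by (subst continuous_on_cong[OF refl eq])
  show "has_pderiv f i a z (pderiv_dir i a f z)" if "z \<in> Cspace n" for z
    using assms(3)[OF i that] eq[OF that] by simp
qed (rule assms(1))

lemma C1_fun_diff:
  assumes "C1_fun n f" "C1_fun n g"
  shows "C1_fun n (\<lambda>z. f z - g z)"
  by (rule C1_funI[where f' = "\<lambda>i a z. pderiv_dir i a f z - pderiv_dir i a g z"])
    (auto intro!: continuous_intros has_pderiv_diff C1_funD[OF assms(1)] C1_funD[OF assms(2)])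

lemma C1_fun_mult:
  assumes "C1_fun n f" "C1_fun n g"
  shows "C1_fun n (\<lambda>z. f z * g z)"
  by (rule C1_funI[where f' = "\<lambda>i a z. f z * pderiv_dir i a g z + pderiv_dir i a f z * g z"])
    (auto intro!: continuous_intros has_pderiv_mult C1_funD[OF assms(1)] C1_funD[OF assms(2)])

lemma C1_fun_real_polys:
  assumes "f \<in> real_polys"
  shows "C1_fun n f"
proof -
  have "\<forall>i a. \<exists>g. g \<in> real_polys \<and> (\<forall>z. has_pderiv f i a z (g z))"
    using real_polys_has_pderiv[OF assms] by blast
  then obtain f' where "\<And>i a. f' i a \<in> real_polys" "\<And>i a z. has_pderiv f i a z (f' i a z)"
    by metis
  then show ?thesis
    using assms by (intro C1_funI[where f' = f'] real_polys_continuous) auto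
qed

lemma continuous_on_locally:
  assumes "\<And>x. x \<in> S \<Longrightarrow> \<exists>V. openin (top_of_set S) V \<and> x \<in> V \<and> continuous_on V f"
  shows "continuous_on S f"
  unfolding continuous_on_def
proof
  fix x assume x: "x \<in> S"
  obtain V where V: "openin (top_of_set S) V" "x \<in> V" "continuous_on V f"
    using assms[OF x] by blast
  obtain T where T: "open T" "V = S \<inter> T"
    using V(1) by (auto simp: openin_open)
  have "at x within S = at x within V"
    by (rule at_within_nhd[OF _ T(1)]) (use V T in auto)
  then show "(f \<longlongrightarrow> f x) (at x within S)"
    using V by (simp add: continuous_on_def)
qed

text \<open>Coefficients of a form are known to be smooth only chart by chart. Continuity and
  partial derivatives are local, so the pieces glue to a global C1 function, and one derivative is
  all that averaging uses.\<close>

lemma C1_fun_locally: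
  assumes "\<And>p. p \<in> Cspace n \<Longrightarrow>
    \<exists>V g. openin (top_of_set (Cspace n)) V \<and> p \<in> V \<and> smooth_fun_on n V g \<and> (\<forall>z\<in>V. f z = g z)"
  shows "C1_fun n f"
  unfolding C1_fun_def
proof (intro conjI allI ballI impI)
  show "continuous_on (Cspace n) f"
  proof (rule continuous_on_locally)
    fix p assume "p \<in> Cspace n"
    then obtain V g where V: "openin (top_of_set (Cspace n)) V" "p \<in> V" "smooth_fun_on n V g" "\<forall>z\<in>V. f z = g z"
      using assms by blast
    have "Ck_on n 0 V g" using V(3) unfolding smooth_fun_on_def ..
    then have "continuous_on V f"
      using continuous_on_cong[OF refl, of V f g] V(4) by simp
    then show "\<exists>V. openin (top_of_set (Cspace n)) V \<and> p \<in> V \<and> continuous_on V f"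
      using V by blast
  qed
  fix i a assume i: "i < n" "a \<in> {1, \<i>}"
  have loc: "\<exists>V. openin (top_of_set (Cspace n)) V \<and> p \<in> V \<and> continuous_on V (pderiv_dir i a f) \<and>
      has_pderiv f i a p (pderiv_dir i a f p)" if p: "p \<in> Cspace n" for p
  proof -
    obtain V g where V: "openin (top_of_set (Cspace n)) V" "p \<in> V" "smooth_fun_on n V g" "\<And>z. z \<in> V \<Longrightarrow> f z = g z"
      using assms[OF p] by blast
    have eq: "pderiv_dir i a f z = pderiv_dir i a g z" if "z \<in> V" for z
      by (rule pderiv_dir_cong[OF V(1) that i(1) V(4)])
    have "Ck_on n (Suc 0) V g" using V(3) unfolding smooth_fun_on_def ..
    then have g: "continuous_on V (pderiv_dir i a g)"
      "\<forall>z\<in>V. (\<lambda>t::real. g (z(i := z i + of_real t * a))) differentiable (at 0)"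
      using i by auto
    have "continuous_on V (pderiv_dir i a f)"
      using g(1) by (subst continuous_on_cong[OF refl eq])
    moreover have "has_pderiv g i a p (pderiv_dir i a g p)"
      using g(2) V(2) by (intro has_pderiv_pderiv_dir) blast
    then have "has_pderiv f i a p (pderiv_dir i a f p)"
      using has_pderiv_cong[OF V(1,2) i(1) V(4)] eq[OF V(2)] by simp
    ultimately show ?thesis using V by blast
  qed
  show "continuous_on (Cspace n) (pderiv_dir i a f)"
    by (rule continuous_on_locally) (use loc in blast)
  show "has_pderiv f i a z (pderiv_dir i a f z)" if "z \<in> Cspace n" for z
    using loc[OF that] by blast
qed

lemma d_zbar_diff:
  assumes "C1_fun n f" "C1_fun n g" "i < n" "z \<in> Cspace n"
  shows "d_zbar i (\<lambda>w. f w - g w) z = d_zbar i f z - d_zbar i g z"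
proof -
  have e: "pderiv_dir i a (\<lambda>w. f w - g w) z = pderiv_dir i a f z - pderiv_dir i a g z"
    if "a \<in> {1, \<i>}" for a
    using assms that by (intro has_pderiv_imp_pderiv_dir has_pderiv_diff C1_funD(3)) auto
  have "pderiv_dir i 1 (\<lambda>w. f w - g w) z = pderiv_dir i 1 f z - pderiv_dir i 1 g z"
    "pderiv_dir i \<i> (\<lambda>w. f w - g w) z = pderiv_dir i \<i> f z - pderiv_dir i \<i> g z"
    by (rule e, simp)+
  then show ?thesis by (simp only: d_zbar_def) (simp add: field_simps)
qed

lemma d_zbar_mult:
  assumes "C1_fun n f" "C1_fun n g" "i < n" "z \<in> Cspace n"
  shows "d_zbar i (\<lambda>w. f w * g w) z = f z * d_zbar i g z + d_zbar i f z * g z"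
proof -
  have "pderiv_dir i a (\<lambda>w. f w * g w) z = f z * pderiv_dir i a g z + pderiv_dir i a f z * g z"
    if "a \<in> {1, \<i>}" for a
    using assms that by (intro has_pderiv_imp_pderiv_dir has_pderiv_mult C1_funD(3)) auto
  then show ?thesis by (simp add: d_zbar_def field_simps)
qed

section \<open>Averaging over line segments\<close>

text \<open>The pair \<open>d\<close> is a coordinate and a real direction in it. The parameter
  interval has length 1, so no normalising factor appears; keeping \<open>z\<close> as an argument
  lets averages be iterated.\<close>

definition avg :: "nat \<times> complex \<Rightarrow> (cvec \<Rightarrow> complex) \<Rightarrow> cvec \<Rightarrow> complex" where
  "avg d f z = integral {0..1} (\<lambda>t::real. f (z(fst d := z (fst d) + of_real t * snd d)))"

lemma avg_cong:
  assumes "\<And>z. z \<in> Cspace n \<Longrightarrow> f z = g z" "z \<in> Cspace n" "fst d < n"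
  shows "avg d f z = avg d g z"
  unfolding avg_def by (rule integral_cong) (simp add: assms Cspace_upd)

lemma line_integrable:
  assumes "continuous_on (Cspace n) f" "z \<in> Cspace n" "i < n"
  shows "continuous_on S (\<lambda>t::real. f (z(i := z i + of_real t * a)))"
proof (rule continuous_on_compose2[OF assms(1)])
  show "continuous_on S (\<lambda>t::real. z(i := z i + of_real t * a))"
    by (intro continuous_intros)
qed (use assms in \<open>auto intro: Cspace_upd\<close>)

lemma avg_continuous:
  assumes "continuous_on (Cspace n) f" "fst d < n"
  shows "continuous_on (Cspace n) (avg d f)"
proof -
  have "continuous_on (Cspace n \<times> cbox 0 1)
      (\<lambda>(z, t::real). f (z(fst d := z (fst d) + of_real t * snd d)))"
    unfolding case_prod_beta
  proof (rule continuous_on_compose2[OF assms(1)])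
    show "continuous_on (Cspace n \<times> cbox 0 1)
        (\<lambda>x. (fst x)(fst d := fst x (fst d) + of_real (snd x) * snd d))"
      by (intro continuous_intros
          continuous_on_product_then_coordinatewise[OF continuous_on_fst[OF continuous_on_id]])
  qed (use assms in \<open>auto simp del: fun_upd_apply intro!: Cspace_upd\<close>)
  from integral_continuous_on_param[OF this] show ?thesis
    by (simp add: avg_def[abs_def])
qed

text \<open>Fubini for a continuous function on the unit square. The two directions may belong to
  the same complex coordinate.\<close>

lemma avg_commute:
  assumes "continuous_on (Cspace n) f" "z \<in> Cspace n" "fst d < n" "fst e < n"
  shows "avg d (avg e f) z = avg e (avg d f) z"
proof -
  define P where "P s t = (z(fst d := z (fst d) + of_real s * snd d))
      (fst e := (z(fst d := z (fst d) + of_real s * snd d)) (fst e) + of_real t * snd e)" for s t :: real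
  \<comment> \<open>Increments add up, so the two orders of updating agree even when
    \<open>fst d = fst e\<close>.\<close>
  have P': "P s t = (z(fst e := z (fst e) + of_real t * snd e))
      (fst d := (z(fst e := z (fst e) + of_real t * snd e)) (fst d) + of_real s * snd d)" for s t
    by (auto simp: P_def fun_eq_iff)
  have "continuous_on (cbox (0,0) (1,1)) (\<lambda>(s, t). f (P s t))"
    unfolding case_prod_beta
  proof (rule continuous_on_compose2[OF assms(1)])
    show "continuous_on (cbox (0,0) (1,1)) (\<lambda>x. P (fst x) (snd x))"
    proof (rule continuous_on_coordinatewise_then_product)
      fix i
      show "continuous_on (cbox (0,0) (1,1)) (\<lambda>x. P (fst x) (snd x) i)"
        unfolding P_def by (cases "i = fst e"; cases "i = fst d"; cases "fst d = fst e")
          (auto intro!: continuous_intros)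
    qed
  qed (auto simp: P_def intro!: Cspace_upd assms)
  from integral_swap_continuous[OF this]
  have "integral {0..1} (\<lambda>s. integral {0..1} (\<lambda>t. f (P s t))) =
      integral {0..1} (\<lambda>t. integral {0..1} (\<lambda>s. f (P s t)))"
    by simp
  moreover have "avg d (avg e f) z = integral {0..1} (\<lambda>s. integral {0..1} (\<lambda>t. f (P s t)))"
    by (simp only: avg_def P_def)
  moreover have "avg e (avg d f) z = integral {0..1} (\<lambda>t. integral {0..1} (\<lambda>s. f (P s t)))"
    by (simp only: avg_def P')
  ultimately show ?thesis by simp
qed

text \<open>The fundamental theorem of calculus along the segment, and the one-dimensional core of
  the Stokes argument.\<close>

lemma avg_pderiv_dir:
  assumes "\<And>w. w \<in> Cspace n \<Longrightarrow> has_pderiv f (fst d) (snd d) w (f' w)" "z \<in> Cspace n" "fst d < n"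
  shows "avg d f' z = f (z(fst d := z (fst d) + snd d)) - f z"
proof -
  define L where "L t = z(fst d := z (fst d) + of_real t * snd d)" for t :: real
  have deriv: "((\<lambda>t. f (L t)) has_vector_derivative f' (L t)) (at t)" for t
    using has_pderiv_line[OF assms(1)[OF Cspace_upd[OF assms(2,3)]], of t] by (simp only: L_def)
  have "((\<lambda>t. f' (L t)) has_integral f (L 1) - f (L 0)) {0..1}"
    by (rule fundamental_theorem_of_calculus[where f = "\<lambda>t. f (L t)"])
      (simp_all add: has_vector_derivative_at_within[OF deriv])
  then show ?thesis
    by (simp add: avg_def L_def integral_unique)
qed

lemma avg_add:
  assumes "continuous_on (Cspace n) f" "continuous_on (Cspace n) g" "z \<in> Cspace n" "fst d < n"
  shows "avg d (\<lambda>w. f w + g w) z = avg d f z + avg d g z"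
  unfolding avg_def by (intro integral_add integrable_continuous_real line_integrable[OF _ assms(3,4)] assms)

lemma avg_cmult: "avg d (\<lambda>w. c * f w) z = c * avg d f z"
  unfolding avg_def by simp

lemma avg_Re_pos:
  assumes "continuous_on (Cspace n) f" "z \<in> Cspace n" "fst d < n"
    and pos: "\<And>w. w \<in> Cspace n \<Longrightarrow> Re (f w) > 0"
  shows "Re (avg d f z) > 0"
proof -
  let ?g = "\<lambda>t::real. f (z(fst d := z (fst d) + of_real t * snd d))"
  have c: "continuous_on {0..1} ?g"
    by (rule line_integrable[OF assms(1-3)])
  have "Re (integral {0..1} ?g) = integral {0..1} (\<lambda>t. Re (?g t))"
    using integral_linear[OF integrable_continuous_real[OF c] bounded_linear_Re] by (simp add: o_def)
  also have "\<dots> > 0"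
  proof -
    have cr: "continuous_on {0..1} (\<lambda>t. Re (?g t))" using c by (intro continuous_intros)
    have p: "Re (?g t) > 0" for t using pos assms by (simp add: Cspace_upd)
    \<comment> \<open>Strictness survives integration because the continuous real part attains its
      minimum on the compact interval, and this minimum is positive.\<close>
    obtain m where m: "m \<in> {0..1}" "\<And>t. t \<in> {0..1} \<Longrightarrow> Re (?g m) \<le> Re (?g t)"
      using continuous_attains_inf[OF _ _ cr] by fastforce
    have "integral {0..1::real} (\<lambda>t. Re (?g m)) \<le> integral {0..1} (\<lambda>t. Re (?g t))"
      using m by (intro integral_le integrable_continuous_real cr) auto
    then show ?thesis using p[of m] by simp
  qed
  finally show ?thesis by (simp add: avg_def)
qed

text \<open>Integer shifts have no effect, so only the fractional part \<open>y\<close> of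
  \<open>x\<close> matters. The part of the shifted interval beyond 1 is moved back by one
  period.\<close>

lemma integral_periodic_shift:
  fixes p :: "real \<Rightarrow> complex"
  assumes cont: "continuous_on UNIV p" and per: "\<And>t. p (t + 1) = p t"
  shows "integral {0..1} (\<lambda>t. p (t + x)) = integral {0..1} p"
proof -
  have int: "p (t + of_int k) = p t" for t k
  proof (induction k rule: int_induct[where k = 0])
    case (step1 i)
    have "p (t + of_int (i + 1)) = p ((t + of_int i) + 1)" by (simp add: add.assoc)
    then show ?case by (simp only: per step1.IH)
  next
    case (step2 i)
    have "p (t + of_int (i - 1)) = p ((t + of_int (i - 1)) + 1)" by (simp only: per)
    also have "(t + of_int (i - 1)) + 1 = t + of_int i" by simp
    finally show ?case by (simp only: step2.IH)
  qed simp
  define y where "y = frac x"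
  have y: "0 \<le> y" "y \<le> 1"
    using frac_lt_1[of x] by (auto simp: y_def)
  have "p (t + x) = p (t + y)" for t
  proof -
    have "t + x = t + y + of_int \<lfloor>x\<rfloor>" by (simp add: y_def frac_def)
    then show ?thesis by (simp only: int)
  qed
  then have "integral {0..1} (\<lambda>t. p (t + x)) = integral {y - y..1 + y - y} (\<lambda>t. p (t + y))"
    by simp
  also have "\<dots> = integral {y..1 + y} p"
    by (rule integral_shift_real_ivl)
  also have "\<dots> = integral {y..1} p + integral {1..1 + y} p"
    using y by (intro Henstock_Kurzweil_Integration.integral_combine [symmetric]
        integrable_continuous_real continuous_on_subset[OF cont]) auto
  also have "integral {1..1 + y} p = integral {1 - 1..1 + y - 1} (\<lambda>t. p (t + 1))"
    by (rule integral_shift_real_ivl [symmetric])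
  also have "\<dots> = integral {0..y} p"
    by (simp add: per)
  also have "integral {y..1} p + integral {0..y} p = integral {0..y} p + integral {y..1} p"
    by (rule add.commute)
  also have "\<dots> = integral {0..1} p"
    using y by (intro Henstock_Kurzweil_Integration.integral_combine
        integrable_continuous_real continuous_on_subset[OF cont]) auto
  finally show ?thesis .
qed

text \<open>The head of the list is the outermost average and its last entry the innermost one. This
  order decides which averages can absorb a shift depending on the other coordinates.\<close>

definition avgs :: "(nat \<times> complex) list \<Rightarrow> (cvec \<Rightarrow> complex) \<Rightarrow> cvec \<Rightarrow> complex" where
  "avgs ds f = foldr avg ds f"

lemma avgs_Nil [simp]: "avgs [] f = f"
  and avgs_Cons [simp]: "avgs (d # ds) f = avg d (avgs ds f)"
  and avgs_append: "avgs (ds @ es) f = avgs ds (avgs es f)"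
  by (simp_all add: avgs_def)

context
  fixes n :: nat and ds :: "(nat \<times> complex) list"
  assumes ds: "fst ` set ds \<subseteq> {..<n}"
begin

lemma avgs_continuous: "continuous_on (Cspace n) f \<Longrightarrow> continuous_on (Cspace n) (avgs ds f)"
  using ds by (induction ds) (auto intro: avg_continuous)

lemma avgs_cong:
  assumes "\<And>z. z \<in> Cspace n \<Longrightarrow> f z = g z" "z \<in> Cspace n"
  shows "avgs ds f z = avgs ds g z"
  using ds assms(2)
proof (induction ds arbitrary: z)
  case (Cons d ds)
  then show ?case by (auto intro!: avg_cong[where n = n])
qed (use assms in simp)

end

lemma avgs_add:
  assumes "fst ` set ds \<subseteq> {..<n}" "continuous_on (Cspace n) f" "continuous_on (Cspace n) g" "z \<in> Cspace n"
  shows "avgs ds (\<lambda>w. f w + g w) z = avgs ds f z + avgs ds g z"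
  using assms(1,4)
proof (induction ds arbitrary: z)
  case (Cons d ds)
  have "avgs (d # ds) (\<lambda>w. f w + g w) z = avg d (\<lambda>w. avgs ds f w + avgs ds g w) z"
    unfolding avgs_Cons using Cons by (intro avg_cong[where n = n]) auto
  also have "\<dots> = avgs (d # ds) f z + avgs (d # ds) g z"
    unfolding avgs_Cons using Cons by (intro avg_add[where n = n] avgs_continuous assms) auto
  finally show ?case .
qed simp

lemma avgs_cmult: "avgs ds (\<lambda>w. c * f w) z = c * avgs ds f z"
proof (induction ds arbitrary: z)
  case (Cons d ds)
  then have "avgs ds (\<lambda>w. c * f w) = (\<lambda>w. c * avgs ds f w)" by blast
  then show ?case by (simp add: avg_cmult)
qed simp

lemma avgs_zero: "avgs ds (\<lambda>z. 0) z = 0"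
  using avgs_cmult[of ds 0 "\<lambda>z. 0" z] by simp

lemma avgs_Re_pos:
  assumes "fst ` set ds \<subseteq> {..<n}" "continuous_on (Cspace n) f" "z \<in> Cspace n"
    and "\<And>w. w \<in> Cspace n \<Longrightarrow> Re (f w) > 0"
  shows "Re (avgs ds f z) > 0"
  using assms(1,3)
proof (induction ds arbitrary: z)
  case (Cons d ds)
  then show ?case unfolding avgs_Cons
    by (intro avg_Re_pos[where n = n] avgs_continuous assms) auto
qed (use assms in simp)

lemma avg_avgs_commute:
  assumes "fst ` set ds \<subseteq> {..<n}" "fst d < n" "continuous_on (Cspace n) f" "z \<in> Cspace n"
  shows "avg d (avgs ds f) z = avgs ds (avg d f) z"
  using assms(1,4)
proof (induction ds arbitrary: z)
  case (Cons e ds)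
  have "avg d (avg e (avgs ds f)) z = avg e (avg d (avgs ds f)) z"
    using Cons by (intro avg_commute[where n = n] avgs_continuous assms) auto
  also have "\<dots> = avg e (avgs ds (avg d f)) z"
    using Cons by (intro avg_cong[where n = n]) auto
  finally show ?case by simp
qed simp

text \<open>Fubini moves the average in the direction of differentiation to the innermost place,
  where it becomes a difference of opposite faces; the other averages then integrate over the
  face.\<close>

lemma avgs_pderiv_dir:
  assumes ds: "fst ` set (xs @ d # ys) \<subseteq> {..<n}"
    and f: "\<And>w. w \<in> Cspace n \<Longrightarrow> has_pderiv f (fst d) (snd d) w (f' w)"
    and f': "continuous_on (Cspace n) f'" and z: "z \<in> Cspace n"
  shows "avgs (xs @ d # ys) f' z =
    avgs (xs @ ys) (\<lambda>w. f (w(fst d := w (fst d) + snd d)) - f w) z"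
proof -
  have "avgs (xs @ d # ys) f' z = avgs xs (avgs ys (avg d f')) z"
    unfolding avgs_append avgs_Cons
    using ds f' z by (intro avgs_cong[where n = n] avg_avgs_commute[where n = n]) auto
  also have "\<dots> = avgs (xs @ ys) (avg d f') z"
    by (simp add: avgs_append)
  also have "\<dots> = avgs (xs @ ys) (\<lambda>w. f (w(fst d := w (fst d) + snd d)) - f w) z"
    using ds by (intro avgs_cong[where n = n] avg_pderiv_dir[where n = n] f z) auto
  finally show ?thesis .
qed

text \<open>The double average runs over a full period torus in the coordinate \<open>i\<close>,
  hence is blind to translation there. The shift \<open>s\<close> is any complex number, not only a
  Gaussian integer.\<close>

lemma avgs_periodic_shift:
  assumes f: "continuous_on (Cspace n) f" "i < n" "z \<in> Cspace n"
    and per: "\<And>w. w \<in> Cspace n \<Longrightarrow> f (w(i := w i + 1)) = f w"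
      "\<And>w. w \<in> Cspace n \<Longrightarrow> f (w(i := w i + \<i>)) = f w"
  shows "avgs [(i, 1), (i, \<i>)] f (z(i := z i + s)) = avgs [(i, 1), (i, \<i>)] f z"
proof -
  have shift: "avg (i, a) g (w(i := w i + of_real x * a)) = avg (i, a) g w"
    if "continuous_on (Cspace n) g" "w \<in> Cspace n"
      "\<And>w. w \<in> Cspace n \<Longrightarrow> g (w(i := w i + a)) = g w" for a x g w
  proof -
    let ?p = "\<lambda>t::real. g (w(i := w i + of_real t * a))"
    have "?p (t + 1) = ?p t" for t
      using that(3)[OF Cspace_upd[OF that(2) f(2)], of "w i + of_real t * a"]
      by (simp add: algebra_simps)
    then have "integral {0..1} (\<lambda>t. ?p (t + x)) = integral {0..1} ?p"
      by (intro integral_periodic_shift line_integrable[OF that(1,2) f(2)])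
    then show ?thesis
      by (simp add: avg_def algebra_simps)
  qed
  have per1: "avg (i, \<i>) f (w(i := w i + 1)) = avg (i, \<i>) f w" if "w \<in> Cspace n" for w
    unfolding avg_def
  proof (rule integral_cong)
    fix t :: real
    show "f ((w(i := w i + 1))(fst (i, \<i>) := (w(i := w i + 1)) (fst (i, \<i>)) + of_real t * snd (i, \<i>))) =
        f (w(fst (i, \<i>) := w (fst (i, \<i>)) + of_real t * snd (i, \<i>)))"
      using per(1)[OF Cspace_upd[OF that f(2)], of "w i + of_real t * \<i>"]
      by (simp add: ac_simps)
  qed
  \<comment> \<open>The real part of \<open>s\<close> is absorbed by the outer average. The
    imaginary part is absorbed after the two averages are exchanged, which puts direction \<i>
    outermost.\<close>
  define w where "w = z(i := z i + of_real (Im s) * \<i>)"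
  have "z(i := z i + s) = w(i := w i + of_real (Re s) * 1)"
  proof -
    have "z i + s = (z i + of_real (Im s) * \<i>) + of_real (Re s) * 1"
      by (simp add: complex_eq_iff)
    then show ?thesis by (simp only: w_def fun_upd_upd fun_upd_same)
  qed
  then have "avg (i, 1) (avg (i, \<i>) f) (z(i := z i + s)) =
      avg (i, 1) (avg (i, \<i>) f) (w(i := w i + of_real (Re s) * 1))"
    by (rule arg_cong)
  also have "\<dots> = avg (i, 1) (avg (i, \<i>) f) (z(i := z i + of_real (Im s) * \<i>))"
    unfolding w_def [symmetric]
    by (rule shift) (use f per1 in \<open>auto simp: w_def intro!: avg_continuous Cspace_upd\<close>)
  also have "\<dots> = avg (i, \<i>) (avg (i, 1) f) (z(i := z i + of_real (Im s) * \<i>))"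
    by (intro avg_commute[where n = n] f Cspace_upd) (use f in auto)
  also have "\<dots> = avg (i, \<i>) (avg (i, 1) f) z"
  proof (rule shift)
    show "avg (i, 1) f (w(i := w i + \<i>)) = avg (i, 1) f w" if "w \<in> Cspace n" for w
      unfolding avg_def
    proof (rule integral_cong)
      fix t :: real
      show "f ((w(i := w i + \<i>))(fst (i, 1) := (w(i := w i + \<i>)) (fst (i, 1)) + of_real t * snd (i, 1))) =
          f (w(fst (i, 1) := w (fst (i, 1)) + of_real t * snd (i, 1)))"
        using per(2)[OF Cspace_upd[OF that f(2)], of "w i + of_real t"]
        by (simp add: ac_simps)
    qed
  qed (use f in \<open>auto intro: avg_continuous\<close>)
  also have "\<dots> = avg (i, 1) (avg (i, \<i>) f) z"
    by (intro avg_commute[where n = n] f) (use f in auto)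
  finally show ?thesis by simp
qed

section \<open>Exterior algebra\<close>

lemma shuffle_sign_empty_left [simp]: "shuffle_sign {} S = 1"
  and shuffle_sign_empty_right [simp]: "shuffle_sign S {} = 1"
  by (simp_all add: shuffle_sign_def)

lemma shuffle_sign_singleton: "shuffle_sign {k} S = (-1) ^ card {b \<in> S. b < k}"
proof -
  have "{(a, b). a \<in> {k} \<and> b \<in> S \<and> b < a} = Pair k ` {b \<in> S. b < k}"
    by auto
  then show ?thesis
    by (simp add: shuffle_sign_def card_image inj_on_def)
qed

lemma shuffle_sign_insert:
  assumes "finite S" "b \<notin> S"
  shows "shuffle_sign {k} (insert b S) = (if b < k then - shuffle_sign {k} S else shuffle_sign {k} S)"
proof -
  have "{x \<in> insert b S. x < k} = (if b < k then insert b {x \<in> S. x < k} else {x \<in> S. x < k})"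
    by auto
  then show ?thesis
    using assms by (simp add: shuffle_sign_singleton)
qed

lemma sum_Pow_singletons:
  assumes "finite I" "\<And>S. S \<subseteq> I \<Longrightarrow> card S \<noteq> 1 \<Longrightarrow> f S = 0"
  shows "sum f (Pow I) = (\<Sum>i\<in>I. f {i})"
proof -
  have "sum f (Pow I) = sum f ((\<lambda>i. {i}) ` I)"
    using assms by (intro sum.mono_neutral_right) (auto simp: card_1_singleton_iff image_iff)
  also have "\<dots> = (\<Sum>i\<in>I. f {i})"
    by (subst sum.reindex) (auto simp: inj_on_def)
  finally show ?thesis .
qed

lemma sum_Pow_empty:
  assumes "finite I" "\<And>S. S \<subseteq> I \<Longrightarrow> S \<noteq> {} \<Longrightarrow> f S = 0"
  shows "sum f (Pow I) = f {}"
  using sum.mono_neutral_right[of "Pow I" "{{}}" f] assms by auto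

lemma sum_Pow_full:
  assumes "finite I" "\<And>S. S \<subseteq> I \<Longrightarrow> S \<noteq> I \<Longrightarrow> f S = 0"
  shows "sum f (Pow I) = f I"
  using sum.mono_neutral_right[of "Pow I" "{I}" f] assms by auto

lemma wedge_cong:
  assumes "\<And>I' J'. I' \<subseteq> I \<Longrightarrow> J' \<subseteq> J \<Longrightarrow> a I' J' = a' I' J'"
    and "\<And>I' J'. I' \<subseteq> I \<Longrightarrow> J' \<subseteq> J \<Longrightarrow> b I' J' = b' I' J'"
  shows "wedge a b I J = wedge a' b' I J"
  unfolding wedge_def by (intro sum.cong refl) (use assms in auto)

lemma wedge_covec_one:
  assumes "finite I" "finite J"
  shows "wedge a covec_one I J = a I J"
proof -
  let ?t = "\<lambda>S T. (-1) ^ (card T * card (I - S)) * shuffle_sign S (I - S) *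
      shuffle_sign T (J - T) * a S T * covec_one (I - S) (J - T)"
  have "wedge a covec_one I J = (\<Sum>T\<in>Pow J. ?t I T)"
    unfolding wedge_def by (rule sum_Pow_full) (use assms in \<open>auto simp: covec_one_def intro!: sum.neutral\<close>)
  also have "\<dots> = ?t I J"
    by (rule sum_Pow_full) (use assms in \<open>auto simp: covec_one_def\<close>)
  finally show ?thesis by (simp add: covec_one_def)
qed

lemma wedge_covec10:
  assumes "finite I" "finite J"
  shows "wedge (covec10 a) b I J = (\<Sum>i\<in>I. shuffle_sign {i} (I - {i}) * a i * b (I - {i}) J)"
proof -
  let ?t = "\<lambda>S T. (-1) ^ (card T * card (I - S)) * shuffle_sign S (I - S) *
      shuffle_sign T (J - T) * covec10 a S T * b (I - S) (J - T)"
  have "wedge (covec10 a) b I J = (\<Sum>i\<in>I. \<Sum>T\<in>Pow J. ?t {i} T)"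
    unfolding wedge_def by (rule sum_Pow_singletons)
      (use assms in \<open>auto simp: covec10_def is_singleton_altdef intro!: sum.neutral\<close>)
  also have "\<dots> = (\<Sum>i\<in>I. ?t {i} {})"
    by (intro sum.cong refl sum_Pow_empty) (use assms in \<open>auto simp: covec10_def\<close>)
  finally show ?thesis by (simp add: covec10_def)
qed

lemma wedge_covec01:
  assumes "finite I" "finite J"
  shows "wedge (covec01 a) b I J =
    (\<Sum>j\<in>J. (-1) ^ card I * shuffle_sign {j} (J - {j}) * a j * b I (J - {j}))"
proof -
  let ?t = "\<lambda>S T. (-1) ^ (card T * card (I - S)) * shuffle_sign S (I - S) *
      shuffle_sign T (J - T) * covec01 a S T * b (I - S) (J - T)"
  have "wedge (covec01 a) b I J = (\<Sum>T\<in>Pow J. ?t {} T)"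
    unfolding wedge_def by (rule sum_Pow_empty)
      (use assms in \<open>auto simp: covec01_def intro!: sum.neutral\<close>)
  also have "\<dots> = (\<Sum>j\<in>J. ?t {} {j})"
    by (rule sum_Pow_singletons) (use assms in \<open>auto simp: covec01_def is_singleton_altdef\<close>)
  finally show ?thesis by (simp add: covec01_def)
qed

text \<open>The index set \<open>N\<close> is explicit because coefficients with indices outside the
  dimension are arbitrary.\<close>

definition pure_covec :: "nat set \<Rightarrow> nat \<Rightarrow> nat \<Rightarrow> covec \<Rightarrow> bool" where
  "pure_covec N p q a \<longleftrightarrow> (\<forall>I\<subseteq>N. \<forall>J\<subseteq>N. \<not> (card I = p \<and> card J = q) \<longrightarrow> a I J = 0)"

lemma pure_covecD:
  "pure_covec N p q a \<Longrightarrow> I \<subseteq> N \<Longrightarrow> J \<subseteq> N \<Longrightarrow> card I \<noteq> p \<or> card J \<noteq> q \<Longrightarrow> a I J = 0"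
  unfolding pure_covec_def by blast

lemma pure_covec_one: "finite N \<Longrightarrow> pure_covec N 0 0 covec_one"
  unfolding pure_covec_def covec_one_def by auto

lemma pure_covec10: "pure_covec N 1 0 (covec10 a)"
  unfolding pure_covec_def covec10_def by (auto simp: is_singleton_altdef)

lemma pure_covec01: "pure_covec N 0 1 (covec01 a)"
  unfolding pure_covec_def covec01_def by (auto simp: is_singleton_altdef)

text \<open>Cardinalities add over each splitting of \<open>I\<close> and \<open>J\<close>; if the
  total is wrong, one of the two factors has the wrong bidegree.\<close>

lemma pure_covec_wedge:
  assumes "finite N" "pure_covec N p q a" "pure_covec N p' q' b"
  shows "pure_covec N (p + p') (q + q') (wedge a b)"
  unfolding pure_covec_def
proof (intro allI impI)
  fix I J assume IJ: "I \<subseteq> N" "J \<subseteq> N" "\<not> (card I = p + p' \<and> card J = q + q')"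
  have "a I1 J1 * b (I - I1) (J - J1) = 0" if "I1 \<subseteq> I" "J1 \<subseteq> J" for I1 J1
  proof -
    have "finite I" "finite J" using IJ assms(1) finite_subset by blast+
    then have "card I = card I1 + card (I - I1)" "card J = card J1 + card (J - J1)"
      using that by (metis card_Diff_subset card_mono finite_subset le_add_diff_inverse)+
    then consider "card I1 \<noteq> p \<or> card J1 \<noteq> q" | "card (I - I1) \<noteq> p' \<or> card (J - J1) \<noteq> q'"
      using IJ(3) by metis
    then show ?thesis
      using pure_covecD[OF assms(2), of I1 J1] pure_covecD[OF assms(3), of "I - I1" "J - J1"] that IJ
      by cases auto
  qed
  then show "wedge a b I J = 0"
    unfolding wedge_def by (intro sum.neutral ballI) (auto simp: mult.assoc)
qed

lemma pure_covec_foldr: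
  assumes "finite N"
  shows "pure_covec N (length xs) (length ys)
    (foldr wedge (map (\<lambda>i. covec10 (A i)) xs @ map (\<lambda>j. covec01 (B j)) ys) covec_one)"
proof (induction xs)
  case Nil
  show ?case
  proof (induction ys)
    case (Cons y ys)
    then show ?case using pure_covec_wedge[OF assms pure_covec01 Cons.IH] by simp
  qed (simp add: pure_covec_one assms)
next
  case (Cons x xs)
  then show ?case using pure_covec_wedge[OF assms pure_covec10 Cons.IH] by simp
qed

lemma wedge_11:
  assumes "finite N" "pure_covec N 1 1 a" "I \<subseteq> N" "J \<subseteq> N"
  shows "wedge a b I J = (\<Sum>i\<in>I. \<Sum>j\<in>J. (-1) ^ card (I - {i}) * shuffle_sign {i} (I - {i}) *
    shuffle_sign {j} (J - {j}) * a {i} {j} * b (I - {i}) (J - {j}))"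
proof -
  have fin: "finite I" "finite J" using assms finite_subset by blast+
  have zero: "a S T = 0" if "S \<subseteq> I" "T \<subseteq> J" "card S \<noteq> 1 \<or> card T \<noteq> 1" for S T
    using pure_covecD[OF assms(2), of S T] that assms by auto
  let ?t = "\<lambda>S T. (-1) ^ (card T * card (I - S)) * shuffle_sign S (I - S) *
      shuffle_sign T (J - T) * a S T * b (I - S) (J - T)"
  have "wedge a b I J = (\<Sum>i\<in>I. \<Sum>T\<in>Pow J. ?t {i} T)"
    unfolding wedge_def by (rule sum_Pow_singletons) (use fin zero in \<open>auto intro!: sum.neutral\<close>)
  also have "\<dots> = (\<Sum>i\<in>I. \<Sum>j\<in>J. ?t {i} {j})"
    by (intro sum.cong refl sum_Pow_singletons) (use fin zero in auto)
  finally show ?thesis by simp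
qed

text \<open>The coefficients of a squared (1,1)-covector are the 2-by-2 minors. The factor 2 counts
  the two orders of the factors, and the sign comes from moving dzbar past dz in dz_i dzbar_k dz_j
  dzbar_l.\<close>

lemma wedge_square_11:
  assumes "finite N" "pure_covec N 1 1 a" "{i, j} \<subseteq> N" "{k, l} \<subseteq> N" "i < j" "k < l"
  shows "wedge_power a 2 {i, j} {k, l} = - 2 * (a {i} {k} * a {j} {l} - a {i} {l} * a {j} {k})"
proof -
  have "wedge_power a 2 {i, j} {k, l} = wedge a a {i, j} {k, l}"
    unfolding wedge_power_def numeral_2_eq_2
    by (simp, rule wedge_cong) (auto intro!: wedge_covec_one dest: finite_subset)
  moreover have "{b. b = j \<and> b < i} = {}" "{b. b = i \<and> b < j} = {i}"
    "{b. b = l \<and> b < k} = {}" "{b. b = k \<and> b < l} = {k}"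
    using assms by auto
  ultimately show ?thesis
    using assms by (simp add: wedge_11[OF assms(1-4)] shuffle_sign_singleton insert_Diff_if algebra_simps)
qed

lemma pure_covec_square_11:
  assumes "finite N" "pure_covec N 1 1 a"
  shows "pure_covec N 2 2 (wedge_power a 2)"
  using pure_covec_wedge[OF assms pure_covec_wedge[OF assms pure_covec_one[OF assms(1)]]]
  by (simp add: wedge_power_def numeral_2_eq_2)

section \<open>Pullbacks\<close>

text \<open>With the Jacobian \<open>D\<close> as a parameter, the exterior algebra is separated
  from the map, and the constant Jacobian of a lattice element can be substituted.\<close>

abbreviation pullback_factor ::
    "(nat \<Rightarrow> nat \<Rightarrow> complex) \<Rightarrow> nat set \<Rightarrow> nat set \<Rightarrow> covec" where
  "pullback_factor D I J \<equiv> foldr wedge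
     (map (\<lambda>i. covec10 (D i)) (sorted_list_of_set I) @
      map (\<lambda>j. covec01 (\<lambda>k. cnj (D j k))) (sorted_list_of_set J)) covec_one"

lemma pullback_eq:
  "pullback n F u z K L = (\<Sum>I\<in>Pow {..<n}. \<Sum>J\<in>Pow {..<n}.
     u (F z) I J * pullback_factor (\<lambda>i k. holo_pderiv k (\<lambda>w. F w i) z) I J K L)"
  unfolding pullback_def ..

lemma pullback_factor_pure:
  assumes "finite I" "finite J" "finite K" "finite L" "card I \<noteq> card K \<or> card J \<noteq> card L"
  shows "pullback_factor D I J K L = 0"
proof (rule pure_covecD[OF pure_covec_foldr[where N = "K \<union> L"]])
  show "card K \<noteq> length (sorted_list_of_set I) \<or> card L \<noteq> length (sorted_list_of_set J)"
    using assms by auto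
qed (use assms in auto)

lemma foldr_wedge_cong:
  assumes "\<And>x I J. x \<in> set xs \<Longrightarrow> I \<subseteq> K \<Longrightarrow> J \<subseteq> L \<Longrightarrow> f x I J = g x I J"
    and "\<And>I J. I \<subseteq> K \<Longrightarrow> J \<subseteq> L \<Longrightarrow> b I J = c I J"
  shows "foldr wedge (map f xs) b K L = foldr wedge (map g xs) c K L"
  using assms
proof (induction xs arbitrary: K L)
  case (Cons x xs)
  show ?case
    unfolding list.map foldr.simps comp_apply
  proof (rule wedge_cong)
    fix I' J' assume *: "I' \<subseteq> K" "J' \<subseteq> L"
    show "f x I' J' = g x I' J'" using Cons.prems * by simp
    show "foldr wedge (map f xs) b I' J' = foldr wedge (map g xs) c I' J'"
      by (rule Cons.IH) (use Cons.prems * in auto)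
  qed
qed simp

lemma pullback_factor_cong:
  assumes "finite I" "finite J" "K \<subseteq> N" "L \<subseteq> N" "\<And>i k. i \<in> I \<union> J \<Longrightarrow> k \<in> N \<Longrightarrow> D i k = E i k"
  shows "pullback_factor D I J K L = pullback_factor E I J K L"
proof -
  have 10: "covec10 (D i) S T = covec10 (E i) S T" if "S \<subseteq> N" "i \<in> I" for i S T
    using that assms(5) by (auto simp: covec10_def is_singleton_def)
  have 01: "covec01 (\<lambda>k. cnj (D i k)) S T = covec01 (\<lambda>k. cnj (E i k)) S T" if "T \<subseteq> N" "i \<in> J" for i S T
    using that assms(5) by (auto simp: covec01_def is_singleton_def)
  show ?thesis
    unfolding foldr_append
    by (intro foldr_wedge_cong 10 01) (use assms in auto)
qed

lemma pullback_cong: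
  assumes "F z = G z" "K \<subseteq> {..<n}" "L \<subseteq> {..<n}"
    and "\<And>i k. i < n \<Longrightarrow> k < n \<Longrightarrow> holo_pderiv k (\<lambda>w. F w i) z = holo_pderiv k (\<lambda>w. G w i) z"
  shows "pullback n F u z K L = pullback n G u z K L"
  unfolding pullback_eq assms(1)
proof (intro sum.cong refl arg_cong2[where f = "(*)"])
  fix I J assume IJ: "I \<in> Pow {..<n}" "J \<in> Pow {..<n}"
  then show "pullback_factor (\<lambda>i k. holo_pderiv k (\<lambda>w. F w i) z) I J K L =
      pullback_factor (\<lambda>i k. holo_pderiv k (\<lambda>w. G w i) z) I J K L"
    by (intro pullback_factor_cong[where N = "{..<n}"])
      (use assms in \<open>auto intro: finite_subset[OF _ finite_lessThan]\<close>)
qed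

text \<open>Each dz pulls back to a (1,0)-covector and each dzbar to a (0,1)-covector, so bidegrees
  are preserved.\<close>

lemma pullback_pure_zero:
  assumes "pure_covec {..<n} p q (u (F z))" "K \<subseteq> {..<n}" "L \<subseteq> {..<n}" "card K \<noteq> p \<or> card L \<noteq> q"
  shows "pullback n F u z K L = 0"
  unfolding pullback_eq
proof (intro sum.neutral ballI)
  fix I J assume IJ: "I \<in> Pow {..<n}" "J \<in> Pow {..<n}"
  have "finite I" "finite J" "finite K" "finite L"
    using IJ assms finite_subset[OF _ finite_lessThan] by blast+
  note fin = this
  show "u (F z) I J * pullback_factor (\<lambda>i k. holo_pderiv k (\<lambda>w. F w i) z) I J K L = 0"
  proof (cases "card I = p \<and> card J = q")
    case True
    then have "pullback_factor (\<lambda>i k. holo_pderiv k (\<lambda>w. F w i) z) I J K L = 0"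
      using assms(4) by (intro pullback_factor_pure fin) auto
    then show ?thesis by simp
  next
    case False
    then show ?thesis
      using pure_covecD[OF assms(1), of I J] IJ by auto
  qed
qed

lemma pullback_10:
  assumes "pure_covec {..<n} 1 0 (u (F z))"
  shows "pullback n F u z {k} {} = (\<Sum>i<n. u (F z) {i} {} * holo_pderiv k (\<lambda>w. F w i) z)"
proof -
  have zero: "u (F z) I J = 0" if "I \<subseteq> {..<n}" "J \<subseteq> {..<n}" "card I \<noteq> 1 \<or> J \<noteq> {}" for I J
  proof (rule pure_covecD[OF assms])
    show "card I \<noteq> 1 \<or> card J \<noteq> 0"
      using that finite_subset[OF that(2)] by auto
  qed (use that in auto)
  let ?t = "\<lambda>I J. u (F z) I J * pullback_factor (\<lambda>i k. holo_pderiv k (\<lambda>w. F w i) z) I J {k} {}"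
  have "pullback n F u z {k} {} = (\<Sum>i<n. \<Sum>J\<in>Pow {..<n}. ?t {i} J)"
    unfolding pullback_eq by (rule sum_Pow_singletons) (use zero in \<open>auto intro!: sum.neutral\<close>)
  also have "\<dots> = (\<Sum>i<n. ?t {i} {})"
    by (intro sum.cong refl sum_Pow_empty) (use zero in auto)
  finally show ?thesis by (simp add: wedge_covec_one covec10_def)
qed

lemma pullback_11:
  assumes "pure_covec {..<n} 1 1 (u (F z))"
  shows "pullback n F u z {k} {l} = (\<Sum>i<n. \<Sum>j<n. u (F z) {i} {j} *
    (holo_pderiv k (\<lambda>w. F w i) z * cnj (holo_pderiv l (\<lambda>w. F w j) z)))"
proof -
  have zero: "u (F z) I J = 0" if "I \<subseteq> {..<n}" "J \<subseteq> {..<n}" "card I \<noteq> 1 \<or> card J \<noteq> 1" for I J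
    by (rule pure_covecD[OF assms]) (use that in auto)
  let ?t = "\<lambda>I J. u (F z) I J * pullback_factor (\<lambda>i k. holo_pderiv k (\<lambda>w. F w i) z) I J {k} {l}"
  have "pullback n F u z {k} {l} = (\<Sum>i<n. \<Sum>J\<in>Pow {..<n}. ?t {i} J)"
    unfolding pullback_eq by (rule sum_Pow_singletons) (use zero in \<open>auto intro!: sum.neutral\<close>)
  also have "\<dots> = (\<Sum>i<n. \<Sum>j<n. ?t {i} {j})"
    by (intro sum.cong refl sum_Pow_singletons) (use zero in auto)
  finally show ?thesis by (simp add: wedge_covec_one wedge_covec10 covec01_def covec10_def)
qed

section \<open>The nilmanifold\<close>

definition gauss_ints :: "complex set" where
  "gauss_ints = {z. Re z \<in> \<int> \<and> Im z \<in> \<int>}"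

lemma gauss_ints_0 [simp]: "0 \<in> gauss_ints"
  and gauss_ints_1 [simp]: "1 \<in> gauss_ints"
  and gauss_ints_ii [simp]: "\<i> \<in> gauss_ints"
  by (simp_all add: gauss_ints_def)

lemma gauss_ints_minus: "z \<in> gauss_ints \<Longrightarrow> - z \<in> gauss_ints"
  and gauss_ints_cnj: "z \<in> gauss_ints \<Longrightarrow> cnj z \<in> gauss_ints"
  and gauss_ints_add: "z \<in> gauss_ints \<Longrightarrow> w \<in> gauss_ints \<Longrightarrow> z + w \<in> gauss_ints"
  and gauss_ints_diff: "z \<in> gauss_ints \<Longrightarrow> w \<in> gauss_ints \<Longrightarrow> z - w \<in> gauss_ints"
  and gauss_ints_mult: "z \<in> gauss_ints \<Longrightarrow> w \<in> gauss_ints \<Longrightarrow> z * w \<in> gauss_ints"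
  by (auto simp: gauss_ints_def)

lemmas gauss_ints_closed_ops =
  gauss_ints_minus gauss_ints_cnj gauss_ints_add gauss_ints_diff gauss_ints_mult

lemma closed_gauss_ints: "closed gauss_ints"
proof -
  have "gauss_ints = Re -` \<int> \<inter> Im -` \<int>"
    by (auto simp: gauss_ints_def)
  moreover have "closed (Re -` \<int>)" "closed (Im -` \<int>)"
    by (rule closed_vimage[OF closed_Ints], intro continuous_intros)+
  ultimately show ?thesis by (metis closed_Int)
qed

lemma gauss_ints_small:
  assumes "z \<in> gauss_ints" "norm z < 1"
  shows "z = 0"
proof -
  have "\<bar>Re z\<bar> < 1" "\<bar>Im z\<bar> < 1"
    using assms(2) abs_Re_le_cmod[of z] abs_Im_le_cmod[of z] by linarith+
  then show ?thesis
    using assms(1) by (auto simp: gauss_ints_def complex_eq_iff elim!: Ints_cases)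
qed

lemma gauss_ints_translate: "\<exists>a\<in>gauss_ints. z + a \<in> cbox 0 (Complex 1 1)"
proof
  let ?a = "Complex (- of_int \<lfloor>Re z\<rfloor>) (- of_int \<lfloor>Im z\<rfloor>)"
  show "?a \<in> gauss_ints"
    by (simp add: gauss_ints_def)
  show "z + ?a \<in> cbox 0 (Complex 1 1)"
    by (simp add: in_cbox_complex_iff) linarith
qed

text \<open>
  Left translations of a nilpotent Lie group structure on complex 3-space; they preserve \<open>dz_0\<close>,
  \<open>dz_1\<close> and \<open>dz_2 + z_0 dz_1 - cnj z_0 dz_0\<close>.
\<close>

definition act :: "complex \<Rightarrow> complex \<Rightarrow> complex \<Rightarrow> cvec \<Rightarrow> cvec" where
  "act a b g z = z(0 := z 0 + a, 1 := z 1 + b, 2 := z 2 + g - a * z 1 + cnj a * z 0)"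

lemma act_apply [simp]:
  "act a b g z 0 = z 0 + a"
  "act a b g z (Suc 0) = z 1 + b"
  "act a b g z 2 = z 2 + g - a * z 1 + cnj a * z 0"
  by (simp_all add: act_def)

lemma all_less_3: "(\<forall>i<3. P i) \<longleftrightarrow> P 0 \<and> P (Suc 0) \<and> P (2::nat)"
  by (auto simp: numeral_3_eq_3 numeral_2_eq_2 less_Suc_eq)

lemma lessThan_3: "{..<3::nat} = {0, 1, 2}"
  by auto

lemma sum_less_3: "(\<Sum>i<3. f i) = f 0 + f (Suc 0) + f (2::nat)"
  by (simp add: numeral_3_eq_3 numeral_2_eq_2)

lemma Cspace_3_eqI:
  assumes "z \<in> Cspace 3" "w \<in> Cspace 3" "z 0 = w 0" "z (Suc 0) = w (Suc 0)" "z 2 = w 2"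
  shows "z = w"
proof
  fix i
  show "z i = w i"
  proof (cases "i < 3")
    case True
    have "\<forall>i<3. z i = w i" using assms by (simp add: all_less_3)
    then show ?thesis using True by blast
  qed (use assms in \<open>auto simp: Cspace_def\<close>)
qed

lemma act_Cspace [simp]: "z \<in> Cspace 3 \<Longrightarrow> act a b g z \<in> Cspace 3"
  by (simp add: act_def Cspace_upd)

lemma act_0 [simp]: "act 0 0 0 z = z"
  by (auto simp: act_def)

text \<open>The group law. It combines the parameters by sums, products and conjugation only, so
  Gaussian integer parameters form a subgroup.\<close>

lemma act_act:
  "act a b g (act a' b' g' z) = act (a + a') (b + b') (g + g' - a * b' + cnj a * a') z"
  by (auto simp: act_def fun_eq_iff algebra_simps)

lemma continuous_on_coord [continuous_intros]: "continuous_on S (\<lambda>z::cvec. z i)"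
  by (rule continuous_on_product_then_coordinatewise[OF continuous_on_id])

lemma continuous_on_act: "continuous_on S (act a b g)"
  unfolding act_def by (intro continuous_intros)

section \<open>Orbits and the quotient topology\<close>

definition orbit_rel :: "cvec \<Rightarrow> cvec \<Rightarrow> bool" where
  "orbit_rel z w \<longleftrightarrow> (\<exists>a\<in>gauss_ints. \<exists>b\<in>gauss_ints. \<exists>g\<in>gauss_ints. w = act a b g z)"

lemma orbit_rel_act:
  "a \<in> gauss_ints \<Longrightarrow> b \<in> gauss_ints \<Longrightarrow> g \<in> gauss_ints \<Longrightarrow> orbit_rel z (act a b g z)"
  unfolding orbit_rel_def by blast

lemma orbit_rel_refl: "orbit_rel z z"
  using orbit_rel_act[of 0 0 0 z] by simp

lemma orbit_rel_sym:
  assumes "orbit_rel z w"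
  shows "orbit_rel w z"
proof -
  obtain a b g where *: "a \<in> gauss_ints" "b \<in> gauss_ints" "g \<in> gauss_ints" "w = act a b g z"
    using assms unfolding orbit_rel_def by blast
  \<comment> \<open>The third parameter solves the composition law \<open>act_act\<close> for the
    identity.\<close>
  have "z = act (-a) (-b) (-g - a * b + cnj a * a) w"
    by (simp add: * act_act)
  then show ?thesis
    using orbit_rel_act[of "-a" "-b" "-g - a * b + cnj a * a" w] *
    by (simp add: gauss_ints_closed_ops)
qed

lemma orbit_rel_trans:
  assumes "orbit_rel z w" "orbit_rel w x"
  shows "orbit_rel z x"
proof -
  obtain a b g where *: "a \<in> gauss_ints" "b \<in> gauss_ints" "g \<in> gauss_ints" "w = act a b g z"
    using assms(1) unfolding orbit_rel_def by blast
  obtain a' b' g' where **: "a' \<in> gauss_ints" "b' \<in> gauss_ints" "g' \<in> gauss_ints" "x = act a' b' g' w"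
    using assms(2) unfolding orbit_rel_def by blast
  show ?thesis
    unfolding **(4) *(4) act_act
    by (rule orbit_rel_act) (simp_all add: * ** gauss_ints_closed_ops)
qed

text \<open>The parameters can be recovered from the two points, starting with a = w_0 - z_0. This
  turns the orbit relation into closed conditions and also yields uniqueness in small
  polydiscs.\<close>

lemma orbit_rel_iff:
  assumes "z \<in> Cspace 3" "w \<in> Cspace 3"
  shows "orbit_rel z w \<longleftrightarrow> w 0 - z 0 \<in> gauss_ints \<and> w (Suc 0) - z (Suc 0) \<in> gauss_ints \<and>
    w 2 - z 2 + (w 0 - z 0) * z (Suc 0) - cnj (w 0 - z 0) * z 0 \<in> gauss_ints" (is "_ \<longleftrightarrow> ?R")
proof
  assume "orbit_rel z w"
  then show ?R unfolding orbit_rel_def by auto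
next
  assume R: ?R
  have "w = act (w 0 - z 0) (w (Suc 0) - z (Suc 0))
      (w 2 - z 2 + (w 0 - z 0) * z (Suc 0) - cnj (w 0 - z 0) * z 0) z"
    by (rule Cspace_3_eqI) (use assms in auto)
  then show "orbit_rel z w"
    unfolding orbit_rel_def using R by blast
qed

text \<open>A point of the quotient is a chosen representative of its orbit, so the points keep the
  type \<open>cvec\<close> that the theorem asks for. The choice depends only on the predicate
  \<open>orbit_rel z\<close>, which is the same along an orbit.\<close>

definition proj :: "cvec \<Rightarrow> cvec" where
  "proj z = (SOME w. orbit_rel z w)"

lemma proj_eq_iff: "proj z = proj w \<longleftrightarrow> orbit_rel z w"
proof
  assume eq: "proj z = proj w"
  have "orbit_rel z (proj z)" "orbit_rel w (proj w)"
    unfolding proj_def using someI[of "orbit_rel z", OF orbit_rel_refl]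
      someI[of "orbit_rel w", OF orbit_rel_refl] by blast+
  then show "orbit_rel z w"
    using eq orbit_rel_sym orbit_rel_trans by metis
next
  assume "orbit_rel z w"
  then have "orbit_rel z = orbit_rel w"
    using orbit_rel_sym orbit_rel_trans by blast
  then show "proj z = proj w"
    by (simp add: proj_def)
qed

definition quotient_topology :: "'a topology \<Rightarrow> ('a \<Rightarrow> 'b) \<Rightarrow> 'b topology" where
  "quotient_topology X q =
     topology (\<lambda>U. U \<subseteq> q ` topspace X \<and> openin X {x \<in> topspace X. q x \<in> U})"

lemma openin_quotient_topology:
  "openin (quotient_topology X q) U \<longleftrightarrow>
     U \<subseteq> q ` topspace X \<and> openin X {x \<in> topspace X. q x \<in> U}"
proof -
  let ?P = "\<lambda>U. U \<subseteq> q ` topspace X \<and> openin X {x \<in> topspace X. q x \<in> U}"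
  have "istopology ?P"
    unfolding istopology_def
  proof (intro conjI allI impI)
    fix S T assume ST: "?P S" "?P T"
    show "S \<inter> T \<subseteq> q ` topspace X" using ST by blast
    have "{x \<in> topspace X. q x \<in> S \<inter> T} = {x \<in> topspace X. q x \<in> S} \<inter> {x \<in> topspace X. q x \<in> T}"
      by blast
    then show "openin X {x \<in> topspace X. q x \<in> S \<inter> T}"
      using ST by (simp only: openin_Int)
  next
    fix \<K> assume K: "\<forall>K\<in>\<K>. ?P K"
    then show "\<Union>\<K> \<subseteq> q ` topspace X" by blast
    have "{x \<in> topspace X. q x \<in> \<Union>\<K>} = (\<Union>K\<in>\<K>. {x \<in> topspace X. q x \<in> K})"
      by blast
    then show "openin X {x \<in> topspace X. q x \<in> \<Union>\<K>}"
      using K by (simp add: openin_clauses(3))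
  qed
  then show ?thesis
    unfolding quotient_topology_def by (simp add: topology_inverse')
qed

lemma topspace_quotient_topology: "topspace (quotient_topology X q) = q ` topspace X"
proof
  show "topspace (quotient_topology X q) \<subseteq> q ` topspace X"
    using openin_quotient_topology[of X q "topspace (quotient_topology X q)"] by simp
  have "{x \<in> topspace X. q x \<in> q ` topspace X} = topspace X"
    by blast
  then have "openin (quotient_topology X q) (q ` topspace X)"
    by (simp add: openin_quotient_topology)
  then show "q ` topspace X \<subseteq> topspace (quotient_topology X q)"
    by (rule openin_subset)
qed

lemma continuous_map_quotient_topology: "continuous_map X (quotient_topology X q) q"
  by (auto simp: continuous_map_def openin_quotient_topology topspace_quotient_topology)

definition nil_top :: "cvec topology" where
  "nil_top = quotient_topology (top_of_set (Cspace 3)) proj"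

lemma topspace_nil_top: "topspace nil_top = proj ` Cspace 3"
  by (simp add: nil_top_def topspace_quotient_topology)

lemma continuous_map_proj: "continuous_map (top_of_set (Cspace 3)) nil_top proj"
  unfolding nil_top_def by (rule continuous_map_quotient_topology)

lemma openin_act_vimage:
  assumes "openin (top_of_set (Cspace 3)) U"
  shows "openin (top_of_set (Cspace 3)) {z \<in> Cspace 3. act a b g z \<in> U}"
proof -
  have "openin (top_of_set (Cspace 3)) (Cspace 3 \<inter> act a b g -` U)"
    by (rule continuous_openin_preimage[OF continuous_on_act _ assms]) auto
  moreover have "{z \<in> Cspace 3. act a b g z \<in> U} = Cspace 3 \<inter> act a b g -` U"
    by blast
  ultimately show ?thesis by simp
qed

text \<open>The saturation of \<open>U\<close> is a union of preimages of \<open>U\<close> under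
  homeomorphisms of the group, hence open.\<close>

lemma open_map_proj: "open_map (top_of_set (Cspace 3)) nil_top proj"
  unfolding open_map_def
proof (intro allI impI)
  fix U assume U: "openin (top_of_set (Cspace 3)) U"
  then have sub: "U \<subseteq> Cspace 3"
    by (rule openin_imp_subset)
  have "{z \<in> Cspace 3. proj z \<in> proj ` U} =
      (\<Union>a\<in>gauss_ints. \<Union>b\<in>gauss_ints. \<Union>g\<in>gauss_ints. {z \<in> Cspace 3. act a b g z \<in> U})"
    by (auto simp: image_iff proj_eq_iff orbit_rel_def; metis)
  moreover have "openin (top_of_set (Cspace 3))
      (\<Union>a\<in>gauss_ints. \<Union>b\<in>gauss_ints. \<Union>g\<in>gauss_ints. {z \<in> Cspace 3. act a b g z \<in> U})"
    by (intro openin_Union ballI) (auto intro!: openin_Union openin_act_vimage U)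
  ultimately show "openin nil_top (proj ` U)"
    using sub by (simp add: nil_top_def openin_quotient_topology image_mono)
qed

text \<open>An open quotient map with closed equivalence relation has a Hausdorff quotient.\<close>

lemma Hausdorff_nil_top: "Hausdorff_space nil_top"
  unfolding Hausdorff_space_def topspace_nil_top
proof (intro allI impI, elim conjE imageE)
  fix x y z w
  assume "x \<noteq> y" and x: "x = proj z" "z \<in> Cspace 3" and y: "y = proj w" "w \<in> Cspace 3"
  \<comment> \<open>The relation in coordinates, written on all pairs of \<open>cvec\<close>: it is
    closed there as a preimage of Gaussian integers, and agrees with \<open>orbit_rel\<close> on
    \<open>Cspace 3\<close>.\<close>
  define R where "R = {p :: cvec \<times> cvec. snd p 0 - fst p 0 \<in> gauss_ints \<and>
    snd p (Suc 0) - fst p (Suc 0) \<in> gauss_ints \<and>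
    snd p 2 - fst p 2 + (snd p 0 - fst p 0) * fst p (Suc 0) -
      cnj (snd p 0 - fst p 0) * fst p 0 \<in> gauss_ints}"
  have c: "continuous_on UNIV (\<lambda>p :: cvec \<times> cvec. fst p i)"
    "continuous_on UNIV (\<lambda>p :: cvec \<times> cvec. snd p i)" for i
    by (rule continuous_on_product_then_coordinatewise, intro continuous_intros)+
  have "R = (\<lambda>p. snd p 0 - fst p 0) -` gauss_ints \<inter> (\<lambda>p. snd p (Suc 0) - fst p (Suc 0)) -` gauss_ints \<inter>
    (\<lambda>p. snd p 2 - fst p 2 + (snd p 0 - fst p 0) * fst p (Suc 0) -
      cnj (snd p 0 - fst p 0) * fst p 0) -` gauss_ints"
    unfolding R_def by auto
  then have "closed R"
    by (simp only:) (intro closed_Int closed_vimage closed_gauss_ints continuous_intros c)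
  have rel: "orbit_rel u v \<longleftrightarrow> (u, v) \<in> R" if "u \<in> Cspace 3" "v \<in> Cspace 3" for u v
    using orbit_rel_iff[OF that] by (simp add: R_def)
  have "(z, w) \<in> - R"
    using \<open>x \<noteq> y\<close> x y rel proj_eq_iff by auto
  then obtain A B where AB: "open A" "open B" "(z, w) \<in> A \<times> B" "A \<times> B \<subseteq> - R"
    using open_prod_elim[of "- R"] \<open>closed R\<close> by (metis open_Compl)
  show "\<exists>U V. openin nil_top U \<and> openin nil_top V \<and> x \<in> U \<and> y \<in> V \<and> disjnt U V"
  proof (intro exI conjI)
    show "openin nil_top (proj ` (Cspace 3 \<inter> A))" "openin nil_top (proj ` (Cspace 3 \<inter> B))"
      using open_map_proj AB unfolding open_map_def by (auto simp: openin_open_Int)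
    show "x \<in> proj ` (Cspace 3 \<inter> A)" "y \<in> proj ` (Cspace 3 \<inter> B)"
      using x y AB by auto
    show "disjnt (proj ` (Cspace 3 \<inter> A)) (proj ` (Cspace 3 \<inter> B))"
      using AB(4) rel by (fastforce simp: disjnt_def proj_eq_iff)
  qed
qed

lemma second_countable_nil_top: "second_countable nil_top"
proof (rule second_countable_open_map_image[OF continuous_map_proj open_map_proj])
  obtain \<B> :: "cvec set set" where B: "countable \<B>" "\<And>C. C \<in> \<B> \<Longrightarrow> open C"
    "\<And>S. open S \<Longrightarrow> \<exists>U. U \<subseteq> \<B> \<and> S = \<Union>U"
    using univ_second_countable by blast
  have "second_countable (euclidean :: cvec topology)"
    unfolding second_countable_def
  proof (intro exI[of _ \<B>] conjI ballI allI impI)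
    fix U x assume "openin euclidean U \<and> x \<in> (U :: cvec set)"
    then show "\<exists>V\<in>\<B>. x \<in> V \<and> V \<subseteq> U"
      using B(3)[of U] by auto
  qed (use B in auto)
  then show "second_countable (top_of_set (Cspace 3))"
    by (rule second_countable_subtopology)
qed (simp add: topspace_nil_top)

lemma compact_nil_top: "compact_space nil_top"
proof -
  \<comment> \<open>Coordinates from 3 on are pinned to 0, so the cube is a compact product inside
    \<open>Cspace 3\<close>.\<close>
  let ?S = "\<lambda>i::nat. if i < 3 then cbox 0 (Complex 1 1) else {0}"
  define K where "K = PiE UNIV ?S"
  have "compactin (product_topology (\<lambda>i. euclidean) UNIV) K"
    unfolding K_def by (simp add: compactin_PiE)
  then have "compact K"
    by (simp add: euclidean_product_topology)
  have K: "K \<subseteq> Cspace 3"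
    by (auto simp: K_def Cspace_def PiE_iff split: if_splits)
  have "proj ` K = proj ` Cspace 3"
  proof
    show "proj ` Cspace 3 \<subseteq> proj ` K"
    proof (rule image_subsetI)
      fix z :: cvec assume z: "z \<in> Cspace 3"
      obtain a where a: "a \<in> gauss_ints" "z 0 + a \<in> cbox 0 (Complex 1 1)"
        using gauss_ints_translate by blast
      obtain b where b: "b \<in> gauss_ints" "z 1 + b \<in> cbox 0 (Complex 1 1)"
        using gauss_ints_translate by blast
      \<comment> \<open>The third parameter is chosen last, since \<open>a\<close> has already
        sheared the third coordinate.\<close>
      obtain g where g: "g \<in> gauss_ints" "(z 2 - a * z 1 + cnj a * z 0) + g \<in> cbox 0 (Complex 1 1)"
        using gauss_ints_translate by blast
      have *: "\<forall>i<3. act a b g z i \<in> cbox 0 (Complex 1 1)"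
        unfolding all_less_3 using a b g by (simp add: algebra_simps)
      have "act a b g z \<in> K"
        using * act_Cspace[OF z, of a b g] by (auto simp: K_def PiE_iff Cspace_def)
      moreover have "proj z = proj (act a b g z)"
        using orbit_rel_act a b g by (simp add: proj_eq_iff)
      ultimately show "proj z \<in> proj ` K" by blast
    qed
  qed (use K in blast)
  moreover have "compactin nil_top (proj ` K)"
    by (rule image_compactin[OF _ continuous_map_proj])
      (use K \<open>compact K\<close> in \<open>simp add: compactin_subtopology\<close>)
  ultimately show ?thesis
    by (simp add: compact_space_def topspace_nil_top)
qed

section \<open>Charts and transition maps\<close>

definition polydisc :: "cvec \<Rightarrow> cvec set" where
  "polydisc p = {z \<in> Cspace 3. \<forall>i<3. norm (z i - p i) < 1 / 2}"

lemma polydisc_subset: "polydisc p \<subseteq> Cspace 3"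
  by (auto simp: polydisc_def)

lemma center_in_polydisc: "p \<in> Cspace 3 \<Longrightarrow> p \<in> polydisc p"
  by (simp add: polydisc_def)

lemma openin_polydisc: "openin (top_of_set (Cspace 3)) (polydisc p)"
proof -
  have "polydisc p = Cspace 3 \<inter> ({z. norm (z 0 - p 0) < 1 / 2} \<inter>
      {z. norm (z (Suc 0) - p (Suc 0)) < 1 / 2} \<inter> {z. norm (z 2 - p 2) < 1 / 2})"
    by (auto simp: polydisc_def all_less_3)
  then show ?thesis
    by (simp only:) (intro openin_open_Int open_Int open_Collect_less continuous_intros)
qed

text \<open>Radius 1/2 makes two points differ by less than 1 in each coordinate, and a Gaussian
  integer of norm below 1 is 0. Once the first coordinates agree, the shear terms in the third
  condition vanish.\<close>

lemma polydisc_orbit_unique: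
  assumes "z \<in> polydisc p" "w \<in> polydisc p" "orbit_rel z w"
  shows "z = w"
proof -
  have C: "z \<in> Cspace 3" "w \<in> Cspace 3"
    using assms by (auto simp: polydisc_def)
  have near: "norm (w i - z i) < 1" if "i < 3" for i
  proof -
    have "norm (w i - p i) < 1 / 2" "norm (z i - p i) < 1 / 2"
      using assms that by (auto simp: polydisc_def)
    then show ?thesis
      using norm_triangle_ineq4[of "w i - p i" "z i - p i"] by simp
  qed
  have R: "w 0 - z 0 \<in> gauss_ints" "w (Suc 0) - z (Suc 0) \<in> gauss_ints"
    "w 2 - z 2 + (w 0 - z 0) * z (Suc 0) - cnj (w 0 - z 0) * z 0 \<in> gauss_ints"
    using assms(3) orbit_rel_iff[OF C] by auto
  have 0: "w 0 - z 0 = 0"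
    by (rule gauss_ints_small[OF R(1)]) (simp add: near)
  have 1: "w (Suc 0) - z (Suc 0) = 0"
    by (rule gauss_ints_small[OF R(2)]) (simp add: near)
  have "w 2 - z 2 = 0"
    by (rule gauss_ints_small) (use R(3) 0 near in auto)
  then show ?thesis
    using C 0 1 by (intro Cspace_3_eqI) auto
qed

lemma inj_on_proj: "inj_on proj (polydisc p)"
  by (auto simp: inj_on_def proj_eq_iff intro: polydisc_orbit_unique)

definition nil_chart :: "cvec \<Rightarrow> cvec chart" where
  "nil_chart p = (proj ` polydisc p, inv_into (polydisc p) proj)"

definition nil_atlas :: "cvec chart set" where
  "nil_atlas = range nil_chart"

lemma fst_nil_chart [simp]: "fst (nil_chart p) = proj ` polydisc p"
  and snd_nil_chart: "snd (nil_chart p) = inv_into (polydisc p) proj"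
  by (simp_all add: nil_chart_def)

lemma snd_nil_chart_proj [simp]: "z \<in> polydisc p \<Longrightarrow> snd (nil_chart p) (proj z) = z"
  by (simp add: snd_nil_chart inj_on_proj)

lemma chart_image_nil_chart [simp]: "snd (nil_chart p) ` proj ` polydisc p = polydisc p"
  by (force simp: image_image)

lemma inv_nil_chart [simp]:
  assumes "z \<in> polydisc p"
  shows "inv_into (proj ` polydisc p) (snd (nil_chart p)) z = proj z"
proof -
  have "inj_on (snd (nil_chart p)) (proj ` polydisc p)"
    by (auto simp: inj_on_def)
  then show ?thesis
    using inv_into_f_f[of "snd (nil_chart p)" "proj ` polydisc p" "proj z"] assms by simp
qed

lemma is_chart_nil_chart: "is_chart 3 nil_top (nil_chart p)"
  unfolding is_chart_def
proof (intro conjI)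
  show "openin nil_top (fst (nil_chart p))"
    using open_map_proj openin_polydisc by (simp add: open_map_def)
  show "openin (top_of_set (Cspace 3)) (chart_image (nil_chart p))"
    by (simp add: openin_polydisc)
  have top: "top_of_set (polydisc p) = subtopology (top_of_set (Cspace 3)) (polydisc p)"
    using polydisc_subset by (simp add: subtopology_subtopology inf.absorb2)
  have "homeomorphic_map (top_of_set (polydisc p)) (subtopology nil_top (proj ` polydisc p)) proj"
  proof (rule bijective_open_imp_homeomorphic_map)
    show "continuous_map (top_of_set (polydisc p)) (subtopology nil_top (proj ` polydisc p)) proj"
      unfolding top using continuous_map_proj
      by (auto simp: continuous_map_in_subtopology intro: continuous_map_from_subtopology)
    show "open_map (top_of_set (polydisc p)) (subtopology nil_top (proj ` polydisc p)) proj"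
      unfolding open_map_def
    proof (intro allI impI)
      fix U assume "openin (top_of_set (polydisc p)) U"
      then have "openin (top_of_set (Cspace 3)) U" "U \<subseteq> polydisc p"
        using openin_trans openin_polydisc openin_imp_subset by blast+
      then show "openin (subtopology nil_top (proj ` polydisc p)) (proj ` U)"
        using open_map_proj unfolding open_map_def openin_subtopology by blast
    qed
    show "proj ` topspace (top_of_set (polydisc p)) = topspace (subtopology nil_top (proj ` polydisc p))"
      using polydisc_subset by (auto simp: topspace_nil_top)
    show "inj_on proj (topspace (top_of_set (polydisc p)))"
      by (simp add: inj_on_proj)
  qed
  then obtain h where h: "homeomorphic_maps (top_of_set (polydisc p))
      (subtopology nil_top (proj ` polydisc p)) proj h"
    unfolding homeomorphic_map_maps by blast
  have "homeomorphic_maps (top_of_set (polydisc p))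
      (subtopology nil_top (proj ` polydisc p)) proj (snd (nil_chart p))"
    by (rule homeomorphic_maps_eq[OF h]) (use h in \<open>auto simp: homeomorphic_maps_def\<close>)
  then have "homeomorphic_map (subtopology nil_top (proj ` polydisc p)) (top_of_set (polydisc p))
      (snd (nil_chart p))"
    using homeomorphic_maps_sym homeomorphic_maps_imp_map by blast
  then show "homeomorphic_map (subtopology nil_top (fst (nil_chart p)))
      (top_of_set (chart_image (nil_chart p))) (snd (nil_chart p))"
    by simp
qed

lemma overlap_nil_chart:
  "snd (nil_chart p) ` (fst (nil_chart p) \<inter> fst (nil_chart p')) =
     {z \<in> polydisc p. \<exists>a\<in>gauss_ints. \<exists>b\<in>gauss_ints. \<exists>g\<in>gauss_ints. act a b g z \<in> polydisc p'}"
proof -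
  have "proj z \<in> proj ` polydisc p' \<longleftrightarrow>
      (\<exists>a\<in>gauss_ints. \<exists>b\<in>gauss_ints. \<exists>g\<in>gauss_ints. act a b g z \<in> polydisc p')" for z
    by (auto simp: image_iff proj_eq_iff orbit_rel_def; metis)
  moreover have "snd (nil_chart p) ` (fst (nil_chart p) \<inter> fst (nil_chart p')) =
      {z \<in> polydisc p. proj z \<in> proj ` polydisc p'}" (is "_ = ?S")
  proof -
    have "fst (nil_chart p) \<inter> fst (nil_chart p') = proj ` ?S"
      by auto
    moreover have "snd (nil_chart p) ` proj ` ?S = ?S"
      by (subst image_image, subst image_cong[OF refl snd_nil_chart_proj]) auto
    ultimately show ?thesis by (simp only:)
  qed
  ultimately show ?thesis by auto
qed

text \<open>Different points of an overlap may need different lattice elements, so the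
  identification is only local. Where \<open>act a b g\<close> lands in the target polydisc,
  injectivity of \<open>proj\<close> there forces the transition to equal it.\<close>

lemma transition_nil_chart:
  assumes "a \<in> gauss_ints" "b \<in> gauss_ints" "g \<in> gauss_ints"
    and "z \<in> polydisc p" "act a b g z \<in> polydisc p'"
  obtains N where "openin (top_of_set (Cspace 3)) N" "z \<in> N" "N \<subseteq> polydisc p"
    "\<And>y. y \<in> N \<Longrightarrow> transition (nil_chart p) (nil_chart p') y = act a b g y"
proof
  let ?N = "polydisc p \<inter> {y \<in> Cspace 3. act a b g y \<in> polydisc p'}"
  show "openin (top_of_set (Cspace 3)) ?N"
    by (intro openin_Int openin_polydisc openin_act_vimage)
  show "z \<in> ?N" "?N \<subseteq> polydisc p"
    using assms polydisc_subset by auto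
  fix y assume y: "y \<in> ?N"
  have "proj y = proj (act a b g y)"
    using assms by (simp add: proj_eq_iff orbit_rel_act)
  then show "transition (nil_chart p) (nil_chart p') y = act a b g y"
    using y by (simp add: transition_def)
qed

text \<open>The Jacobian matrix of \<open>act a b g\<close>: the maps are affine, so it is constant,
  and it depends on \<open>a\<close> alone.\<close>

definition act_jac :: "complex \<Rightarrow> nat \<Rightarrow> nat \<Rightarrow> complex" where
  "act_jac a i k = (if i = 2 then (if k = 0 then cnj a else if k = 1 then - a else if k = 2 then 1 else 0)
     else if i = k then 1 else 0)"

lemma has_field_derivative_act:
  assumes "i < 3"
  shows "((\<lambda>w. act a b g (z(k := w)) i) has_field_derivative act_jac a i k) (at x)"
proof -
  consider "i = 0" | "i = 1" | "i = 2" using assms by linarith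
  then show ?thesis
  proof cases
    case 1
    then show ?thesis
      by (cases "k = 0") (auto simp: act_jac_def intro!: derivative_eq_intros)
  next
    case 2
    then show ?thesis
      by (cases "k = 1") (auto simp: act_jac_def intro!: derivative_eq_intros)
  next
    case 3
    consider "k = 0" | "k = 1" | "k = 2" | "k > 2" by linarith
    then show ?thesis
      using 3 by cases (auto simp: act_jac_def intro!: derivative_eq_intros)
  qed
qed

lemma holo_pderiv_act: "i < 3 \<Longrightarrow> holo_pderiv k (\<lambda>w. act a b g w i) z = act_jac a i k"
  unfolding holo_pderiv_def by (rule DERIV_imp_deriv[OF has_field_derivative_act])

lemma pullback_transition:
  assumes "a \<in> gauss_ints" "b \<in> gauss_ints" "g \<in> gauss_ints"
    and "z \<in> polydisc p" "act a b g z \<in> polydisc p'" "K \<subseteq> {..<3}" "L \<subseteq> {..<3}"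
  shows "pullback 3 (transition (nil_chart p) (nil_chart p')) u z K L = pullback 3 (act a b g) u z K L"
proof -
  obtain N where N: "openin (top_of_set (Cspace 3)) N" "z \<in> N"
    "\<And>y. y \<in> N \<Longrightarrow> transition (nil_chart p) (nil_chart p') y = act a b g y"
    using transition_nil_chart[OF assms(1-5)] by metis
  show ?thesis
  proof (rule pullback_cong)
    fix i k :: nat assume "i < 3" "k < 3"
    have "\<forall>\<^sub>F w in nhds (z k). transition (nil_chart p) (nil_chart p') (z(k := w)) i = act a b g (z(k := w)) i"
      using eventually_upd_mem[OF N(1,2) \<open>k < 3\<close>] by eventually_elim (simp add: N(3))
    then show "holo_pderiv k (\<lambda>w. transition (nil_chart p) (nil_chart p') w i) z =
        holo_pderiv k (\<lambda>w. act a b g w i) z"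
      unfolding holo_pderiv_def by (rule deriv_cong_ev) simp
  qed (use assms N in auto)
qed

lemma holo_transition:
  assumes "j < 3"
  shows "holo_fun_on 3 (snd (nil_chart p) ` (fst (nil_chart p) \<inter> fst (nil_chart p')))
    (\<lambda>z. transition (nil_chart p) (nil_chart p') z j)"
  unfolding holo_fun_on_def
proof (intro conjI ballI allI impI)
  let ?S = "snd (nil_chart p) ` (fst (nil_chart p) \<inter> fst (nil_chart p'))"
  let ?f = "\<lambda>z. transition (nil_chart p) (nil_chart p') z j"
  have loc: "\<exists>N a b g. openin (top_of_set (Cspace 3)) N \<and> z \<in> N \<and> (\<forall>y\<in>N. ?f y = act a b g y j)"
    if z: "z \<in> ?S" for z
  proof -
    obtain a b g where "a \<in> gauss_ints" "b \<in> gauss_ints" "g \<in> gauss_ints"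
      "z \<in> polydisc p" "act a b g z \<in> polydisc p'"
      using z unfolding overlap_nil_chart by blast
    from transition_nil_chart[OF this] show ?thesis by metis
  qed
  have S: "?S \<subseteq> Cspace 3"
    using polydisc_subset unfolding overlap_nil_chart by blast
  show "continuous_on ?S ?f"
    unfolding continuous_on_def
  proof
    fix z assume z: "z \<in> ?S"
    from loc[OF z] obtain N a b g where
      N: "openin (top_of_set (Cspace 3)) N" "z \<in> N" "\<forall>y\<in>N. ?f y = act a b g y j"
      by (elim exE conjE)
    obtain T where T: "open T" "N = Cspace 3 \<inter> T"
      using N(1) by (auto simp: openin_open)
    have "\<forall>\<^sub>F y in at z within ?S. act a b g y j = ?f y"
      unfolding eventually_at_topological
    proof (intro exI[of _ T] conjI ballI impI)
      show "z \<in> T" using N T by blast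
      fix y assume "y \<in> T" "y \<in> ?S"
      then have "y \<in> N" using T S by blast
      then show "act a b g y j = ?f y" using N by simp
    qed (fact T(1))
    moreover have "((\<lambda>y. act a b g y j) \<longlongrightarrow> act a b g z j) (at z within ?S)"
      using continuous_on_product_then_coordinatewise[OF continuous_on_act] z
      unfolding continuous_on_def by blast
    ultimately show "(?f \<longlongrightarrow> ?f z) (at z within ?S)"
      using N by (simp add: tendsto_cong)
  qed
  fix z i assume z: "z \<in> ?S" and i: "i < (3::nat)"
  from loc[OF z] obtain N a b g where
    N: "openin (top_of_set (Cspace 3)) N" "z \<in> N" "\<forall>y\<in>N. ?f y = act a b g y j"
    by (elim exE conjE)
  have ev: "\<forall>\<^sub>F w in nhds (z i). ?f (z(i := w)) = act a b g (z(i := w)) j"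
    using eventually_upd_mem[OF N(1,2) i] by eventually_elim (use N in blast)
  have "((\<lambda>w. ?f (z(i := w))) has_field_derivative act_jac a j i) (at (z i))"
    using has_field_derivative_act[OF assms, of a b g z i "z i"] by (subst DERIV_cong_ev[OF refl ev refl])
  then show "(\<lambda>w. ?f (z(i := w))) field_differentiable at (z i)"
    unfolding field_differentiable_def by blast
qed

lemma compact_complex_manifold_nil: "compact_complex_manifold 3 nil_top nil_atlas"
  unfolding compact_complex_manifold_def complex_manifold_def
proof (intro conjI ballI allI impI)
  show "(\<Union>c\<in>nil_atlas. fst c) = topspace nil_top"
  proof -
    have "(\<Union>p. polydisc p) = Cspace 3"
      using polydisc_subset center_in_polydisc by blast
    then have "(\<Union>p. proj ` polydisc p) = proj ` Cspace 3"
      by (metis image_UN)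
    then show ?thesis
      by (simp add: nil_atlas_def topspace_nil_top)
  qed
qed (auto simp: nil_atlas_def Hausdorff_nil_top second_countable_nil_top compact_nil_top
    is_chart_nil_chart simp del: fst_nil_chart intro: holo_transition)

section \<open>Forms on the nilmanifold\<close>

text \<open>Transition maps are locally lattice elements, so compatibility in the atlas becomes
  equivariance under \<open>act\<close>, with no chart inverse left.\<close>

lemma smooth_form_nil_iff:
  "smooth_form 3 nil_atlas u \<longleftrightarrow>
     (\<forall>p. \<forall>I\<subseteq>{..<3}. \<forall>J\<subseteq>{..<3}. smooth_fun_on 3 (polydisc p) (\<lambda>z. u (nil_chart p) z I J)) \<and>
     (\<forall>p p' z. \<forall>a\<in>gauss_ints. \<forall>b\<in>gauss_ints. \<forall>g\<in>gauss_ints.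
        z \<in> polydisc p \<longrightarrow> act a b g z \<in> polydisc p' \<longrightarrow> (\<forall>K\<subseteq>{..<3}. \<forall>L\<subseteq>{..<3}.
          u (nil_chart p) z K L = pullback 3 (act a b g) (u (nil_chart p')) z K L))"
  (is "_ \<longleftrightarrow> ?smooth \<and> ?compat")
proof -
  have "(\<forall>c\<in>nil_atlas. \<forall>c'\<in>nil_atlas. \<forall>z \<in> snd c ` (fst c \<inter> fst c'). \<forall>K\<subseteq>{..<3}. \<forall>L\<subseteq>{..<3}.
      u c z K L = pullback 3 (transition c c') (u c') z K L) \<longleftrightarrow> ?compat" (is "?A \<longleftrightarrow> _")
  proof
    assume A: ?A
    show ?compat
    proof (intro allI ballI impI)
      fix p p' z a b g and K L :: "nat set"
      assume *: "a \<in> gauss_ints" "b \<in> gauss_ints" "g \<in> gauss_ints" "z \<in> polydisc p"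
        "act a b g z \<in> polydisc p'" "K \<subseteq> {..<3}" "L \<subseteq> {..<3}"
      then have "z \<in> snd (nil_chart p) ` (fst (nil_chart p) \<inter> fst (nil_chart p'))"
        unfolding overlap_nil_chart by blast
      then have "u (nil_chart p) z K L =
          pullback 3 (transition (nil_chart p) (nil_chart p')) (u (nil_chart p')) z K L"
        using A *(6,7) unfolding nil_atlas_def by blast
      then show "u (nil_chart p) z K L = pullback 3 (act a b g) (u (nil_chart p')) z K L"
        by (simp add: pullback_transition[OF *])
    qed
  next
    assume C: ?compat
    show ?A
      unfolding nil_atlas_def
    proof (intro ballI allI impI, elim rangeE)
      fix c c' p p' z and K L :: "nat set"
      assume c: "c = nil_chart p" "c' = nil_chart p'" and z: "z \<in> snd c ` (fst c \<inter> fst c')"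
        and KL: "K \<subseteq> {..<3}" "L \<subseteq> {..<3}"
      obtain a b g where *: "a \<in> gauss_ints" "b \<in> gauss_ints" "g \<in> gauss_ints"
        "z \<in> polydisc p" "act a b g z \<in> polydisc p'"
        using z unfolding c overlap_nil_chart by blast
      show "u c z K L = pullback 3 (transition c c') (u c') z K L"
        unfolding c pullback_transition[OF * KL] using C * KL by blast
    qed
  qed
  then show ?thesis
    unfolding smooth_form_def nil_atlas_def by simp
qed

text \<open>The coordinates of 3-space serve all charts at once, so one left-invariant form on
  3-space represents a form on the quotient.\<close>

lemma smooth_form_invariant:
  assumes "\<And>I J. I \<subseteq> {..<3} \<Longrightarrow> J \<subseteq> {..<3} \<Longrightarrow> (\<lambda>z. U z I J) \<in> real_polys"
    and "\<And>a b g z K L. K \<subseteq> {..<3} \<Longrightarrow> L \<subseteq> {..<3} \<Longrightarrow> U z K L = pullback 3 (act a b g) U z K L"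
  shows "smooth_form 3 nil_atlas (\<lambda>c. U)"
  unfolding smooth_form_nil_iff using assms by (auto intro: real_polys_smooth)

text \<open>The rows are the coefficients of the invariant forms \<open>dz_0\<close>, \<open>dz_1\<close> and \<open>dz_2 + z_0 dz_1 - cnj z_0 dz_0\<close>.\<close>

definition coframe :: "cvec \<Rightarrow> nat \<Rightarrow> nat \<Rightarrow> complex" where
  "coframe z m k = (if m = 2 then (if k = 0 then - cnj (z 0) else if k = 1 then z 0 else if k = 2 then 1 else 0)
     else if m = k then 1 else 0)"

lemma coframe_real_polys: "(\<lambda>z. coframe z m k) \<in> real_polys"
  unfolding coframe_def
  by (cases "m = 2"; cases "k = 0"; cases "k = 1"; cases "k = 2")
    (auto intro: real_polys.const real_polys.coord real_polys.cnj_coord real_polys_uminus)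

lemma coframe_invariant:
  assumes "m < 3" "k < 3"
  shows "coframe z m k = (\<Sum>i<3. coframe (act a b g z) m i * act_jac a i k)"
proof -
  have "\<forall>m<3. \<forall>k<3. coframe z m k = (\<Sum>i<3. coframe (act a b g z) m i * act_jac a i k)"
    unfolding all_less_3 sum_less_3 by (simp add: coframe_def act_jac_def)
  then show ?thesis using assms by blast
qed

section \<open>The invariant metric and its strongly Gauduchon property\<close>

definition nil_metric :: lform where
  "nil_metric z I J = (if is_singleton I \<and> is_singleton J
     then \<i> * (\<Sum>m<3. coframe z m (the_elem I) * cnj (coframe z m (the_elem J))) else 0)"

lemma pure_nil_metric: "pure_covec N 1 1 (nil_metric z)"
  by (auto simp: pure_covec_def nil_metric_def is_singleton_altdef)

lemma nil_metric_invariant: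
  assumes "K \<subseteq> {..<3}" "L \<subseteq> {..<3}"
  shows "nil_metric z K L = pullback 3 (act a b g) nil_metric z K L"
proof (cases "card K = 1 \<and> card L = 1")
  case True
  then obtain k l where KL: "K = {k}" "L = {l}" and less: "k < 3" "l < 3"
    using assms by (auto simp: card_1_singleton_iff)
  let ?c = "coframe (act a b g z)"
  have "nil_metric z K L = \<i> * (\<Sum>m<3. (\<Sum>i<3. ?c m i * act_jac a i k) * cnj (\<Sum>j<3. ?c m j * act_jac a j l))"
    using coframe_invariant[OF _ less(1), of _ z a b g] coframe_invariant[OF _ less(2), of _ z a b g]
    by (simp add: nil_metric_def KL)
  also have "\<dots> = (\<Sum>i<3. \<Sum>j<3. nil_metric (act a b g z) {i} {j} * (act_jac a i k * cnj (act_jac a j l)))"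
    by (simp add: nil_metric_def sum_less_3 algebra_simps)
  also have "\<dots> = pullback 3 (act a b g) nil_metric z K L"
    unfolding KL by (simp add: pullback_11[OF pure_nil_metric] holo_pderiv_act)
  finally show ?thesis .
next
  case False
  then show ?thesis
    using pure_covecD[OF pure_nil_metric assms] pullback_pure_zero[OF pure_nil_metric assms] by auto
qed

lemma pos_def_nil_metric: "pos_def_hermitian 3 (\<lambda>j k. - \<i> * nil_metric z {j} {k})"
  unfolding pos_def_hermitian_def
proof (intro conjI allI impI)
  fix j k :: nat
  show "- \<i> * nil_metric z {k} {j} = cnj (- \<i> * nil_metric z {j} {k})"
    by (simp add: nil_metric_def mult.commute)
next
  fix v :: "nat \<Rightarrow> complex" assume v: "\<exists>j<3. v j \<noteq> 0"
  \<comment> \<open>The value of the third coframe covector on \<open>v\<close>. The Hermitian form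
    is the sum of the squared norms of the three coframe values.\<close>
  let ?l = "v 2 + z 0 * v (Suc 0) - cnj (z 0) * v 0"
  have "(\<Sum>j<3. \<Sum>k<3. - \<i> * nil_metric z {j} {k} * v j * cnj (v k)) =
      v 0 * cnj (v 0) + v (Suc 0) * cnj (v (Suc 0)) + ?l * cnj ?l"
    by (simp add: nil_metric_def sum_less_3 coframe_def algebra_simps)
  also have "\<dots> = of_real ((norm (v 0))\<^sup>2 + (norm (v (Suc 0)))\<^sup>2 + (norm ?l)\<^sup>2)"
    by (simp only: complex_norm_square of_real_add)
  finally have eq: "Re (\<Sum>j<3. \<Sum>k<3. - \<i> * nil_metric z {j} {k} * v j * cnj (v k)) =
      (norm (v 0))\<^sup>2 + (norm (v (Suc 0)))\<^sup>2 + (norm ?l)\<^sup>2"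
    by (simp only: Re_complex_of_real)
  have "v 0 \<noteq> 0 \<or> v (Suc 0) \<noteq> 0 \<or> ?l \<noteq> 0"
  proof (rule ccontr)
    assume "\<not> ?thesis"
    then have "\<forall>i<3. v i = 0" unfolding all_less_3 by auto
    then show False using v by blast
  qed
  then have "(norm (v 0))\<^sup>2 > 0 \<or> (norm (v (Suc 0)))\<^sup>2 > 0 \<or> (norm ?l)\<^sup>2 > 0"
    by simp
  then show "0 < Re (\<Sum>j<3. \<Sum>k<3. - \<i> * nil_metric z {j} {k} * v j * cnj (v k))"
    unfolding eq by (smt (verit) zero_le_power2)
qed

lemma smooth_nil_metric: "smooth_form 3 nil_atlas (\<lambda>c. nil_metric)"
proof (rule smooth_form_invariant)
  show "(\<lambda>z. nil_metric z I J) \<in> real_polys" for I J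
    unfolding nil_metric_def
    by (cases "is_singleton I \<and> is_singleton J")
      (auto intro!: real_polys.mult real_polys.const real_polys_sum coframe_real_polys
        real_polys_cnj[OF coframe_real_polys])
qed (rule nil_metric_invariant)

lemma hermitian_nil_metric: "hermitian_metric 3 nil_atlas (\<lambda>c. nil_metric)"
  unfolding hermitian_metric_def pure_type_def
  using smooth_nil_metric pos_def_nil_metric pure_covecD[OF pure_nil_metric, of _ "{..<3}"] by blast

text \<open>A primitive, with respect to \<open>delbar\<close>, of the \<open>del\<close>-derivative of the squared metric.\<close>

definition nil_primitive :: lform where
  "nil_primitive z I J = (if I = {0, 1, 2} then - 2 * covec01 (\<lambda>k. cnj (coframe z 2 k)) {} J else 0)"

lemma pure_nil_primitive: "pure_covec N 3 1 (nil_primitive z)"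
  by (auto simp: pure_covec_def nil_primitive_def covec01_def is_singleton_altdef)

text \<open>The Jacobian is unipotent, so dz_0 \<and> dz_1 \<and> dz_2 is preserved and only the
  antiholomorphic entry remains.\<close>

lemma pullback_factor_act_full:
  assumes "l < 3"
  shows "pullback_factor (act_jac a) {0, 1, 2} {j} {0, 1, 2} {l} = cnj (act_jac a j l)"
  by (simp add: wedge_covec10 wedge_covec01 wedge_covec_one insert_Diff_if act_jac_def
      covec01_def shuffle_sign_insert)

lemma nil_primitive_invariant:
  assumes "K \<subseteq> {..<3}" "L \<subseteq> {..<3}"
  shows "nil_primitive z K L = pullback 3 (act a b g) nil_primitive z K L"
proof (cases "card K = 3 \<and> card L = 1")
  case True
  have "K = {..<3}" using True assms card_subset_eq[of "{..<3}" K] by simp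
  then have K: "K = {0, 1, 2}" by (simp add: lessThan_3)
  obtain l where L: "L = {l}" and l: "l < 3"
    using True assms by (auto simp: card_1_singleton_iff)
  let ?t = "\<lambda>I J. nil_primitive (act a b g z) I J * pullback_factor (\<lambda>i k. holo_pderiv k (\<lambda>w. act a b g w i) z) I J K L"
  have "pullback 3 (act a b g) nil_primitive z K L = (\<Sum>J\<in>Pow {..<3}. ?t {..<3} J)"
    unfolding pullback_eq
    by (rule sum_Pow_full) (auto simp: nil_primitive_def lessThan_3 intro!: sum.neutral)
  also have "\<dots> = (\<Sum>j<3. ?t {..<3} {j})"
    by (rule sum_Pow_singletons) (auto simp: nil_primitive_def covec01_def is_singleton_altdef)
  also have "\<dots> = (\<Sum>j<3. - 2 * cnj (coframe (act a b g z) 2 j) * cnj (act_jac a j l))"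
  proof (rule sum.cong)
    fix j assume "j \<in> {..<3::nat}"
    have "pullback_factor (\<lambda>i k. holo_pderiv k (\<lambda>w. act a b g w i) z) {..<3} {j} K L =
        pullback_factor (act_jac a) {..<3} {j} K L"
      by (rule pullback_factor_cong[where N = "{..<3}"])
        (use assms \<open>j \<in> {..<3}\<close> in \<open>auto simp: holo_pderiv_act\<close>)
    also have "\<dots> = cnj (act_jac a j l)"
      unfolding lessThan_3 K L by (rule pullback_factor_act_full[OF l])
    finally show "?t {..<3} {j} = - 2 * cnj (coframe (act a b g z) 2 j) * cnj (act_jac a j l)"
      by (simp add: nil_primitive_def lessThan_3 covec01_def)
  qed simp
  also have "\<dots> = - 2 * cnj (\<Sum>j<3. coframe (act a b g z) 2 j * act_jac a j l)"
    by (simp add: sum_less_3 algebra_simps)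
  also have "\<dots> = nil_primitive z K L"
    using coframe_invariant[OF _ l, of 2 z a b g] by (simp add: nil_primitive_def K L covec01_def)
  finally show ?thesis ..
next
  case False
  then show ?thesis
    using pure_covecD[OF pure_nil_primitive assms] pullback_pure_zero[OF pure_nil_primitive assms] by auto
qed

lemma smooth_nil_primitive: "smooth_form 3 nil_atlas (\<lambda>c. nil_primitive)"
proof (rule smooth_form_invariant)
  show "(\<lambda>z. nil_primitive z I J) \<in> real_polys" for I J
    unfolding nil_primitive_def covec01_def
    by (cases "I = {0, 1, 2}"; cases "is_singleton J")
      (auto intro!: real_polys.mult[OF real_polys.const] real_polys.const
        real_polys_cnj[OF coframe_real_polys] real_polys_uminus)
qed (rule nil_primitive_invariant)

lemma subset_3_cases:
  assumes "I \<subseteq> {..<3::nat}"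
  shows "I \<in> {{}, {0}, {1}, {2}, {0, 1}, {0, 2}, {1, 2}, {0, 1, 2}}"
proof -
  have "I \<in> Pow {0, 1, 2}" using assms by (simp add: lessThan_3)
  then show ?thesis by (simp add: Pow_insert) blast
qed

text \<open>Both sides have type (3,2). On the left one differentiates the coefficients 2 z_0, 0, 2
  of dz_1 dz_2 dzbar_J for J = {0,1}, {0,2}, {1,2} in z_0, so only J = {0,1} survives, with value 2.
  The coefficient - 2 cnj z_0 of the primitive gives the same value once dzbar_0 has passed three
  dz; this fixes the factor - 2.\<close>

lemma del_nil_metric_square:
  assumes I: "I \<subseteq> {..<3}" and J: "J \<subseteq> {..<3}"
  shows "local_del (\<lambda>z. wedge_power (nil_metric z) 2) z I J = local_delbar nil_primitive z I J"
proof (cases "I = {0, 1, 2} \<and> card J = 2")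
  case True
  have sq: "wedge_power (nil_metric w) 2 {i, j} {k, l} =
      - 2 * (nil_metric w {i} {k} * nil_metric w {j} {l} - nil_metric w {i} {l} * nil_metric w {j} {k})"
    if "i < j" "k < l" "j < 3" "l < 3" for w i j k l
    by (rule wedge_square_11[where N = "{..<3}"]) (use that pure_nil_metric in auto)
  \<comment> \<open>The metric depends on the point only through z_0, so only \<open>d_z 0\<close>
    can contribute to \<open>local_del\<close>.\<close>
  have indep: "wedge_power (nil_metric (w(k := c))) 2 S J = wedge_power (nil_metric w) 2 S J"
    if "k \<noteq> 0" for w c k S
  proof -
    have "(w(k := c)) 0 = w 0" using that by auto
    then have "coframe (w(k := c)) = coframe w"
      by (intro ext) (simp only: coframe_def)
    then have "nil_metric (w(k := c)) = nil_metric w"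
      by (intro ext) (simp only: nil_metric_def)
    then show ?thesis by simp
  qed
  have zero: "d_z k (\<lambda>w. wedge_power (nil_metric w) 2 S J) z = 0" if "k \<noteq> 0" for k S
    by (rule d_z_indep(1)) (rule indep[OF that])
  have del: "local_del (\<lambda>z. wedge_power (nil_metric z) 2) z I J =
      d_z 0 (\<lambda>w. wedge_power (nil_metric w) 2 {1, 2} J) z"
    using True zero by (simp add: local_del_def insert_Diff_if shuffle_sign_insert)
  consider "J = {0, 1}" | "J = {0, 2}" | "J = {1, 2}"
    using subset_3_cases[OF J] True by auto
  then show ?thesis
  proof cases
    case 1
    have "wedge_power (nil_metric w) 2 {1, 2} J = 2 * w 0" for w
      unfolding 1 by (simp add: sq nil_metric_def sum_less_3 coframe_def algebra_simps)
    then show ?thesis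
      unfolding del using True 1
      by (simp add: local_delbar_def insert_Diff_if shuffle_sign_insert nil_primitive_def
          covec01_def coframe_def)
  next
    case 2
    have "wedge_power (nil_metric w) 2 {1, 2} J = 0" for w
      unfolding 2 by (simp add: sq nil_metric_def sum_less_3 coframe_def algebra_simps)
    then show ?thesis
      unfolding del using True 2
      by (simp add: local_delbar_def insert_Diff_if shuffle_sign_insert nil_primitive_def
          covec01_def coframe_def)
  next
    case 3
    have "wedge_power (nil_metric w) 2 {1, 2} J = 2" for w
      unfolding 3 by (simp add: sq nil_metric_def sum_less_3 coframe_def algebra_simps)
    then show ?thesis
      unfolding del using True 3
      by (simp add: local_delbar_def insert_Diff_if shuffle_sign_insert nil_primitive_def
          covec01_def coframe_def)
  qed
next
  case False
  have fin: "finite I" "finite J"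
    using I J finite_subset by blast+
  have "local_delbar nil_primitive z I J = 0"
    unfolding local_delbar_def
  proof (rule sum.neutral, rule ballI)
    fix k assume "k \<in> J"
    then have "I \<noteq> {0, 1, 2} \<or> card (J - {k}) \<noteq> 1"
      using False fin by auto
    then have "nil_primitive w I (J - {k}) = 0" for w
      by (auto simp: nil_primitive_def covec01_def is_singleton_altdef)
    then show "(-1) ^ card I * shuffle_sign {k} (J - {k}) *
        d_zbar k (\<lambda>w. nil_primitive w I (J - {k})) z = 0"
      by simp
  qed
  moreover have "local_del (\<lambda>z. wedge_power (nil_metric z) 2) z I J = 0"
    unfolding local_del_def
  proof (rule sum.neutral, rule ballI)
    fix k assume k: "k \<in> I"
    have "card (I - {k}) \<noteq> 2 \<or> card J \<noteq> 2"
    proof (rule ccontr)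
      assume "\<not> ?thesis"
      then have "card I = 3" "card J = 2" using k fin by auto
      then have "I = {..<3}" using I card_subset_eq[of "{..<3}" I] by simp
      then show False using False \<open>card J = 2\<close> by (simp add: lessThan_3)
    qed
    then have "wedge_power (nil_metric w) 2 (I - {k}) J = 0" for w
      by (intro pure_covecD[OF pure_covec_square_11[OF finite_lessThan pure_nil_metric]])
        (use I J in auto)
    then show "shuffle_sign {k} (I - {k}) *
        d_z k (\<lambda>w. wedge_power (nil_metric w) 2 (I - {k}) J) z = 0"
      by simp
  qed
  ultimately show ?thesis by simp
qed

lemma strongly_Gauduchon_nil: "strongly_Gauduchon_manifold 3 nil_atlas"
  unfolding strongly_Gauduchon_manifold_def sG_metric_def
proof (intro exI conjI)
  show "hermitian_metric 3 nil_atlas (\<lambda>c. nil_metric)"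
    by (rule hermitian_nil_metric)
  have "form_power (\<lambda>c. nil_metric) (3 - 1) c = (\<lambda>z. wedge_power (nil_metric z) 2)" for c :: "cvec chart"
    by (simp add: form_power_def fun_eq_iff)
  then show "delbar_exact 3 nil_atlas (del (form_power (\<lambda>c. nil_metric) (3 - 1)))"
    unfolding delbar_exact_def form_eq_def del_def delbar_def
    by (intro exI[of _ "\<lambda>c. nil_primitive"])
      (simp add: smooth_nil_primitive del_nil_metric_square)
qed

section \<open>Failure of the del-delbar lemma\<close>

definition nil_form10 :: lform where
  "nil_form10 z = covec10 (coframe z 2)"

definition nil_form20 :: lform where
  "nil_form20 z I J = (if I = {0, 1} \<and> J = {} then 1 else 0)"

lemma smooth_nil_form10: "smooth_form 3 nil_atlas (\<lambda>c. nil_form10)"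
proof (rule smooth_form_invariant)
  show "(\<lambda>z. nil_form10 z I J) \<in> real_polys" for I J
    unfolding nil_form10_def covec10_def
    by (cases "is_singleton I"; cases "J = {}") (simp_all add: real_polys.const coframe_real_polys)
  fix a b g z K L assume KL: "K \<subseteq> {..<3::nat}" "L \<subseteq> {..<3::nat}"
  have pure: "pure_covec {..<3} 1 0 (nil_form10 w)" for w
    unfolding nil_form10_def by (rule pure_covec10)
  show "nil_form10 z K L = pullback 3 (act a b g) nil_form10 z K L"
  proof (cases "card K = 1 \<and> card L = 0")
    case True
    then obtain k where K: "K = {k}" "k < 3" and L: "L = {}"
      using KL finite_subset[OF KL(2)] by (auto simp: card_1_singleton_iff)
    show ?thesis
      using coframe_invariant[OF _ K(2), of 2 z a b g]
      by (simp add: K(1) L pullback_10[OF pure] holo_pderiv_act nil_form10_def covec10_def)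
  next
    case False
    then show ?thesis
      using pure_covecD[OF pure KL] pullback_pure_zero[OF pure KL] by auto
  qed
qed

lemma smooth_nil_form20: "smooth_form 3 nil_atlas (\<lambda>c. nil_form20)"
proof (rule smooth_form_invariant)
  show "(\<lambda>z. nil_form20 z I J) \<in> real_polys" for I J
    unfolding nil_form20_def by (rule real_polys.const)
  fix a b g z K L assume KL: "K \<subseteq> {..<3::nat}" "L \<subseteq> {..<3::nat}"
  let ?t = "\<lambda>I J. nil_form20 (act a b g z) I J * pullback_factor (\<lambda>i k. holo_pderiv k (\<lambda>w. act a b g w i) z) I J K L"
  have "pullback 3 (act a b g) nil_form20 z K L = (\<Sum>I\<in>Pow {..<3}. ?t I {})"
    unfolding pullback_eq
    by (intro sum.cong refl sum_Pow_empty) (auto simp: nil_form20_def)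
  also have "\<dots> = (\<Sum>I\<in>{{0, 1}}. ?t I {})"
    by (rule sum.mono_neutral_right) (auto simp: nil_form20_def)
  also have "\<dots> = pullback_factor (\<lambda>i k. holo_pderiv k (\<lambda>w. act a b g w i) z) {0, 1} {} K L"
    by (simp add: nil_form20_def)
  also have "\<dots> = pullback_factor (act_jac a) {0, 1} {} K L"
  proof (rule pullback_factor_cong)
    show "K \<subseteq> {..<3}" "L \<subseteq> {..<3}" by (fact KL)+
    fix i k :: nat assume "i \<in> {0, 1} \<union> {}"
    then have "i < 3" by auto
    then show "holo_pderiv k (\<lambda>w. act a b g w i) z = act_jac a i k"
      by (rule holo_pderiv_act)
  qed simp_all
  also have "\<dots> = nil_form20 z K L"
  proof (cases "card K = 2 \<and> L = {}")
    case True
    then have "K \<in> {{0, 1}, {0, 2}, {1, 2}}"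
      using subset_3_cases[OF KL(1)] by (elim insertE emptyE) simp_all
    then show ?thesis
      using True by (elim insertE emptyE)
        \<comment> \<open>The rows 0 and 1 of the Jacobian are unit vectors, so among the 2-by-2
          minors of these rows only the one for {0, 1} is nonzero, and it is 1.\<close>
        (simp_all add: wedge_covec10 wedge_covec_one insert_Diff_if act_jac_def covec10_def
          nil_form20_def shuffle_sign_insert doubleton_eq_iff)
  next
    case False
    have fin: "finite K" "finite L" using KL finite_subset by blast+
    then have "pullback_factor (act_jac a) {0, 1} {} K L = 0"
      using False by (intro pullback_factor_pure) auto
    moreover have "nil_form20 z K L = 0"
      using False by (auto simp: nil_form20_def)
    ultimately show ?thesis by (simp only:)
  qed
  finally show "nil_form20 z K L = pullback 3 (act a b g) nil_form20 z K L" ..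
qed

text \<open>The coefficient - cnj z_0 is antiholomorphic, so \<partial> sees only the coefficient
  z_0 of dz_1.\<close>

lemma del_nil_form10:
  assumes "I \<subseteq> {..<3}" "J \<subseteq> {..<3}"
  shows "local_del nil_form10 z I J = nil_form20 z I J"
  using subset_3_cases[OF assms(1)]
  by (cases "J = {}") (auto simp: local_del_def nil_form10_def nil_form20_def covec10_def
      insert_Diff_if coframe_def shuffle_sign_insert is_singleton_def d_z_indep)

lemma not_del_delbar_lemma_nil: "\<not> satisfies_del_delbar_lemma 3 nil_atlas"
proof
  let ?u = "\<lambda>c::cvec chart. nil_form20"
  assume ddbar: "satisfies_del_delbar_lemma 3 nil_atlas"
  have "pure_type 3 nil_atlas 2 0 ?u"
    unfolding pure_type_def nil_form20_def by auto
  moreover have "d_closed 3 nil_atlas ?u"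
    unfolding d_closed_def form_eq_def ext_d_def del_def delbar_def form_zero_def
      local_del_def local_delbar_def nil_form20_def by simp
  moreover have "del_exact 3 nil_atlas ?u"
    unfolding del_exact_def form_eq_def del_def
    using smooth_nil_form10 del_nil_form10 by (intro exI[of _ "\<lambda>c. nil_form10"]) auto
  ultimately have "delbar_exact 3 nil_atlas ?u"
    using ddbar smooth_nil_form20 unfolding satisfies_del_delbar_lemma_def by blast
  then obtain v where "form_eq 3 nil_atlas ?u (delbar v)"
    unfolding delbar_exact_def by blast
  moreover have "nil_chart (\<lambda>i. 0) \<in> nil_atlas" "(\<lambda>i. 0) \<in> chart_image (nil_chart (\<lambda>i. 0))"
    "{0, 1} \<subseteq> {..<3::nat}" "{} \<subseteq> {..<3::nat}"
    by (auto simp: nil_atlas_def Cspace_def intro: center_in_polydisc)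
  \<comment> \<open>One point suffices: for an empty antiholomorphic index set
    \<open>local_delbar\<close> is an empty sum, whatever \<open>v\<close> is.\<close>
  ultimately have "nil_form20 (\<lambda>i. 0) {0, 1} {} = delbar v (nil_chart (\<lambda>i. 0)) (\<lambda>i. 0) {0, 1} {}"
    unfolding form_eq_def by blast
  then show False
    by (simp add: nil_form20_def delbar_def local_delbar_def)
qed

section \<open>Balanced metrics\<close>

lemma pos_def_hermitian_minor:
  assumes "pos_def_hermitian 3 h"
  shows "0 < Re (h 1 1 * h 2 2 - h 1 2 * h 2 1)"
proof -
  have herm: "h k j = cnj (h j k)" if "j < 3" "k < 3" for j k
    using assms that unfolding pos_def_hermitian_def by blast
  have pos: "0 < Re (\<Sum>j<3. \<Sum>k<3. h j k * v j * cnj (v k))" if "j < 3" "v j \<noteq> 0" for v j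
    using assms that unfolding pos_def_hermitian_def by blast
  have r0: "0 < Re (h 2 2)"
    using pos[of 2 "\<lambda>i. if i = 2 then 1 else 0"] by (simp add: sum_less_3)
  have r: "h 2 2 = of_real (Re (h 2 2))"
    using herm[of 2 2] by (simp add: complex_eq_iff)
  have c: "cnj (h 2 2) = h 2 2" "cnj (h 1 2) = h 2 1"
    using herm[of 2 2] herm[of 1 2] by simp_all
  \<comment> \<open>A vector on which the Hermitian form takes the value \<open>h 2 2\<close> times
    the minor; it is orthogonal, for this form, to the basis vector with index 2.\<close>
  let ?v = "\<lambda>i::nat. if i = 1 then h 2 2 else if i = 2 then - h 1 2 else 0"
  have "(\<Sum>j<3. \<Sum>k<3. h j k * ?v j * cnj (?v k)) = h 2 2 * (h 1 1 * h 2 2 - h 1 2 * h 2 1)"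
    using c by (simp add: sum_less_3 algebra_simps)
  moreover have "?v 1 \<noteq> 0" using r0 by auto
  ultimately have "0 < Re (h 2 2 * (h 1 1 * h 2 2 - h 1 2 * h 2 1))"
    using pos[of 1 ?v] by simp
  then have "0 < Re (h 2 2) * Re (h 1 1 * h 2 2 - h 1 2 * h 2 1)"
    by (subst (asm) r) simp
  then show ?thesis
    using r0 by (simp add: zero_less_mult_iff)
qed

lemma act_fibre: "act 0 b 0 z = z(1 := z 1 + b)" "act 0 0 g z = z(2 := z 2 + g)"
  by (auto simp: act_def fun_eq_iff)

locale nil_balanced =
  fixes u :: "cvec form"
  assumes balanced: "balanced_metric 3 nil_atlas u"
begin

lemma herm: "hermitian_metric 3 nil_atlas u"
  and closed: "d_closed 3 nil_atlas (form_power u (3 - 1))"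
  using balanced unfolding balanced_metric_def by auto

lemma pure: "z \<in> polydisc p \<Longrightarrow> pure_covec {..<3} 1 1 (u (nil_chart p) z)"
  using herm unfolding hermitian_metric_def pure_type_def pure_covec_def nil_atlas_def by force

text \<open>The chart centred at \<open>z\<close> itself is used, which makes the coefficients
  functions on all of 3-space: the lift of the metric to the covering space.\<close>

definition w :: "nat \<Rightarrow> nat \<Rightarrow> cvec \<Rightarrow> complex" where
  "w j k z = u (nil_chart z) z {j} {k}"

lemma chart_transform:
  assumes "a \<in> gauss_ints" "b \<in> gauss_ints" "g \<in> gauss_ints" "z \<in> polydisc p"
    "act a b g z \<in> polydisc p'" "k < 3" "l < 3"
  shows "u (nil_chart p) z {k} {l} = (\<Sum>i<3. \<Sum>j<3. u (nil_chart p') (act a b g z) {i} {j} *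
    (act_jac a i k * cnj (act_jac a j l)))"
proof -
  have "smooth_form 3 nil_atlas u"
    using herm unfolding hermitian_metric_def by blast
  then have "u (nil_chart p) z {k} {l} = pullback 3 (act a b g) (u (nil_chart p')) z {k} {l}"
    unfolding smooth_form_nil_iff using assms by simp
  then show ?thesis
    by (simp add: pullback_11[where F = "act a b g" and u = "u (nil_chart p')", OF pure[OF assms(5)]] holo_pderiv_act)
qed

lemma w_transform:
  assumes "a \<in> gauss_ints" "b \<in> gauss_ints" "g \<in> gauss_ints" "z \<in> Cspace 3" "k < 3" "l < 3"
  shows "w k l z = (\<Sum>i<3. \<Sum>j<3. w i j (act a b g z) * (act_jac a i k * cnj (act_jac a j l)))"
  unfolding w_def by (rule chart_transform) (use assms center_in_polydisc in auto)

text \<open>Both charts contain \<open>z\<close> and are compared by the trivial lattice element,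
  whose Jacobian is the identity.\<close>

lemma w_local:
  assumes "z \<in> polydisc p" "k < 3" "l < 3"
  shows "u (nil_chart p) z {k} {l} = w k l z"
proof -
  have "z \<in> Cspace 3" using assms(1) polydisc_subset by blast
  then have "z \<in> polydisc z" by (rule center_in_polydisc)
  then have "u (nil_chart p) z {k} {l} =
      (\<Sum>i<3. \<Sum>j<3. w i j z * (act_jac 0 i k * cnj (act_jac 0 j l)))"
    using chart_transform[of 0 0 0 z p z k l] assms by (simp add: w_def)
  also have "\<dots> = w k l z"
  proof -
    have "\<forall>k<3. \<forall>l<3. (\<Sum>i<3. \<Sum>j<3. w i j z * (act_jac 0 i k * cnj (act_jac 0 j l))) = w k l z"
      unfolding all_less_3 sum_less_3 by (simp add: act_jac_def)
    then show ?thesis using assms by blast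
  qed
  finally show ?thesis .
qed

lemma C1_w:
  assumes "k < 3" "l < 3"
  shows "C1_fun 3 (w k l)"
proof (rule C1_fun_locally)
  fix p assume p: "p \<in> Cspace 3"
  have "smooth_fun_on 3 (polydisc p) (\<lambda>z. u (nil_chart p) z {k} {l})"
    using herm assms unfolding hermitian_metric_def smooth_form_nil_iff by simp
  then show "\<exists>V g. openin (top_of_set (Cspace 3)) V \<and> p \<in> V \<and> smooth_fun_on 3 V g \<and>
      (\<forall>z\<in>V. w k l z = g z)"
    using openin_polydisc center_in_polydisc[OF p] w_local[OF _ assms]
    by (intro exI[of _ "polydisc p"] exI[of _ "\<lambda>z. u (nil_chart p) z {k} {l}"]) auto
qed

definition minor :: "nat \<Rightarrow> nat \<Rightarrow> nat \<Rightarrow> nat \<Rightarrow> cvec \<Rightarrow> complex" where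
  "minor i j k l z = w i k z * w j l z - w i l z * w j k z"

lemma C1_minor:
  assumes "i < 3" "j < 3" "k < 3" "l < 3"
  shows "C1_fun 3 (minor i j k l)"
  unfolding minor_def[abs_def] using assms by (intro C1_fun_diff C1_fun_mult C1_w)

lemma square_local:
  assumes "z \<in> polydisc p" "i < j" "j < 3" "k < l" "l < 3"
  shows "wedge_power (u (nil_chart p) z) 2 {i, j} {k, l} = - 2 * minor i j k l z"
  using assms wedge_square_11[OF finite_lessThan pure[OF assms(1)], of i j k l]
  by (simp add: w_local minor_def)

text \<open>The component of dz_i dz_j dzbar_0 dzbar_1 dzbar_2 in d(\<omega> \<and> \<omega>) = 0,
  divided by - 2; the alternating signs are shuffle signs.\<close>

lemma closed_minor:
  assumes "i < j" "j < 3" "z \<in> Cspace 3"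
  shows "d_zbar 0 (minor i j 1 2) z - d_zbar 1 (minor i j 0 2) z + d_zbar 2 (minor i j 0 1) z = 0"
proof -
  let ?S = "\<lambda>y. wedge_power (u (nil_chart z) y) 2"
  have z: "z \<in> polydisc z" by (rule center_in_polydisc[OF assms(3)])
  have bar: "d_zbar m (\<lambda>y. ?S y {i, j} {k, l}) z = - 2 * d_zbar m (minor i j k l) z"
    if "k < l" "l < 3" "m < 3" for k l m
  proof -
    have "d_zbar m (\<lambda>y. ?S y {i, j} {k, l}) z = d_zbar m (\<lambda>y. - 2 * minor i j k l y) z"
      by (rule d_zbar_cong[OF openin_polydisc z that(3)]) (rule square_local, use that assms in auto)
    also have "\<dots> = - 2 * d_zbar m (minor i j k l) z"
    proof -
      have "C1_fun 3 (minor i j k l)" using that assms by (intro C1_minor) auto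
      from d_zbar_mult[OF C1_fun_real_polys[OF real_polys.const] this that(3) assms(3), of "- 2"]
      show ?thesis by simp
    qed
    finally show ?thesis .
  qed
  \<comment> \<open>A contribution would need a coefficient of type (1,3), but the square has type
    (2,2).\<close>
  have "local_del ?S z {i, j} {0, 1, 2} = 0"
    unfolding local_del_def
  proof (rule sum.neutral, rule ballI)
    fix k assume k: "k \<in> {i, j}"
    have "d_z k (\<lambda>y. ?S y ({i, j} - {k}) {0, 1, 2}) z = d_z k (\<lambda>y. 0) z"
    proof (rule d_z_cong[OF openin_polydisc z])
      fix y assume "y \<in> polydisc z"
      show "?S y ({i, j} - {k}) {0, 1, 2} = 0"
        by (rule pure_covecD[OF pure_covec_square_11[OF finite_lessThan pure[OF \<open>y \<in> polydisc z\<close>]]])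
          (use assms in auto)
    qed (use k assms in auto)
    then show "shuffle_sign {k} ({i, j} - {k}) * d_z k (\<lambda>y. ?S y ({i, j} - {k}) {0, 1, 2}) z = 0"
      by simp
  qed
  moreover have "local_del ?S z {i, j} {0, 1, 2} + local_delbar ?S z {i, j} {0, 1, 2} = 0"
  proof -
    have S: "form_power u (3 - 1) c = (\<lambda>y. wedge_power (u c y) 2)" for c
      by (simp add: form_power_def fun_eq_iff)
    have "nil_chart z \<in> nil_atlas" "z \<in> chart_image (nil_chart z)"
      using z by (simp_all add: nil_atlas_def)
    moreover have "{i, j} \<subseteq> {..<3}" "{0, 1, 2} \<subseteq> {..<3::nat}"
      using assms by auto
    ultimately have "ext_d (form_power u (3 - 1)) (nil_chart z) z {i, j} {0, 1, 2} =
        form_zero (nil_chart z) z {i, j} {0, 1, 2}"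
      using closed unfolding d_closed_def form_eq_def by blast
    then show ?thesis
      unfolding ext_d_def del_def delbar_def form_zero_def S .
  qed
  ultimately have "local_delbar ?S z {i, j} {0, 1, 2} = 0"
    by simp
  moreover have "card {i, j} = 2" using assms by simp
  ultimately have "2 * (d_zbar 0 (minor i j 1 2) z - d_zbar 1 (minor i j 0 2) z +
      d_zbar 2 (minor i j 0 1) z) = 0"
    using bar[of 1 2 0] bar[of 0 2 1] bar[of 0 1 2]
    by (simp add: local_delbar_def insert_Diff_if shuffle_sign_insert algebra_simps)
  then show ?thesis by (metis mult_eq_0_iff zero_neq_numeral)
qed

text \<open>
  Up to a constant factor, the coefficient of \<open>dz_0 dz_1 dz_2 dzbar_k dzbar_l\<close> in the wedge product
  of the invariant form \<open>dz_2 + z_0 dz_1 - cnj z_0 dz_0\<close> and the squared metric.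
\<close>

definition eta :: "nat \<Rightarrow> nat \<Rightarrow> cvec \<Rightarrow> complex" where
  "eta k l z = minor 0 1 k l z - z 0 * minor 0 2 k l z - cnj (z 0) * minor 1 2 k l z"

lemma C1_eta:
  assumes "k < 3" "l < 3"
  shows "C1_fun 3 (eta k l)"
  unfolding eta_def[abs_def] using assms
  by (intro C1_fun_diff C1_fun_mult C1_minor C1_fun_real_polys real_polys.coord real_polys.cnj_coord) auto

text \<open>The Leibniz rule. Of the two multipliers only cnj z_0 is not holomorphic, and it
  produces the extra term for \<open>m = 0\<close>.\<close>

lemma d_zbar_eta:
  assumes "k < 3" "l < 3" "m < 3" "z \<in> Cspace 3"
  shows "d_zbar m (eta k l) z = d_zbar m (minor 0 1 k l) z - z 0 * d_zbar m (minor 0 2 k l) z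
    - cnj (z 0) * d_zbar m (minor 1 2 k l) z - (if m = 0 then minor 1 2 k l z else 0)"
proof -
  have C: "C1_fun 3 (minor 0 1 k l)" "C1_fun 3 (minor 0 2 k l)" "C1_fun 3 (minor 1 2 k l)"
    "C1_fun 3 (\<lambda>z. z 0)" "C1_fun 3 (\<lambda>z. cnj (z 0))"
    using assms by (auto intro: C1_minor C1_fun_real_polys real_polys.coord real_polys.cnj_coord)
  show ?thesis
    unfolding eta_def[abs_def]
    by (simp only: d_zbar_diff[OF C1_fun_diff[OF C(1) C1_fun_mult[OF C(4,2)]] C1_fun_mult[OF C(5,3)] assms(3,4)]
        d_zbar_diff[OF C(1) C1_fun_mult[OF C(4,2)] assms(3,4)]
        d_zbar_mult[OF C(4,2) assms(3,4)] d_zbar_mult[OF C(5,3) assms(3,4)]) simp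
qed

text \<open>The three instances of \<open>closed_minor\<close> cancel the differentiated minors.
  What is left is, up to a constant, the coefficient of dz_0 \<and> dzbar_0 \<and> \<omega> \<and>
  \<omega>.\<close>

lemma divergence_eta:
  assumes z: "z \<in> Cspace 3"
  shows "d_zbar 0 (eta 1 2) z - d_zbar 1 (eta 0 2) z + d_zbar 2 (eta 0 1) z = - minor 1 2 1 2 z"
proof -
  note c = closed_minor[OF _ _ z]
  have "d_zbar 0 (eta 1 2) z - d_zbar 1 (eta 0 2) z + d_zbar 2 (eta 0 1) z =
    (d_zbar 0 (minor 0 1 1 2) z - d_zbar 1 (minor 0 1 0 2) z + d_zbar 2 (minor 0 1 0 1) z)
    - z 0 * (d_zbar 0 (minor 0 2 1 2) z - d_zbar 1 (minor 0 2 0 2) z + d_zbar 2 (minor 0 2 0 1) z)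
    - cnj (z 0) * (d_zbar 0 (minor 1 2 1 2) z - d_zbar 1 (minor 1 2 0 2) z + d_zbar 2 (minor 1 2 0 1) z)
    - minor 1 2 1 2 z"
    by (simp add: d_zbar_eta[OF _ _ _ z] algebra_simps)
  also have "\<dots> = - minor 1 2 1 2 z"
    using c[of 0 1] c[of 0 2] c[of 1 2] by simp
  finally show ?thesis .
qed

text \<open>The coefficients satisfy w = \<i> h for the positive definite matrix h, so each minor of
  w is minus that of h.\<close>

lemma divergence_pos:
  assumes z: "z \<in> Cspace 3"
  shows "0 < Re (- minor 1 2 1 2 z)"
proof -
  have "nil_chart z \<in> nil_atlas" "z \<in> chart_image (nil_chart z)"
    using center_in_polydisc[OF z] by (simp_all add: nil_atlas_def)
  then have "pos_def_hermitian 3 (\<lambda>j k. - \<i> * w j k z)"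
    using herm unfolding hermitian_metric_def w_def by blast
  from pos_def_hermitian_minor[OF this] show ?thesis
    by (simp add: minor_def)
qed

text \<open>For \<open>a = 0\<close> the Jacobian is the identity and z_0 is unchanged, so
  \<open>eta\<close> is periodic in z_1 and z_2.\<close>

lemma eta_fibre_invariant:
  assumes "b \<in> gauss_ints" "g \<in> gauss_ints" "z \<in> Cspace 3" "k < 3" "l < 3"
  shows "eta k l (act 0 b g z) = eta k l z"
proof -
  have "\<forall>k<3. \<forall>l<3. w k l z = w k l (act 0 b g z)"
    unfolding all_less_3
    by (simp add: w_transform[OF gauss_ints_0 assms(1-3)] sum_less_3 act_jac_def)
  then have "w k l (act 0 b g z) = w k l z" if "k < 3" "l < 3" for k l
    using that by simp
  then show ?thesis
    using assms(4,5) by (simp add: eta_def minor_def)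
qed

text \<open>Under pullback the dzbar_1 dzbar_2 coefficient comes from the same coefficient alone. It
  is the one component that the divergence differentiates in z_0.\<close>

lemma eta_12_invariant:
  assumes "a \<in> gauss_ints" "z \<in> Cspace 3"
  shows "eta 1 2 (act a 0 0 z) = eta 1 2 z"
proof -
  note t = w_transform[OF assms(1) gauss_ints_0 gauss_ints_0 assms(2)]
  show ?thesis
    unfolding eta_def minor_def
    by (simp add: t sum_less_3 act_jac_def algebra_simps)
qed

text \<open>The six edges of the unit cube; the z_2 directions stand last so that their averages are
  innermost.\<close>

abbreviation cell :: "(nat \<times> complex) list" where
  "cell \<equiv> [(0, 1), (0, \<i>), (1, 1), (1, \<i>), (2, 1), (2, \<i>)]"

text \<open>Opposite faces in these directions are matched by a translation under which
  \<open>eta\<close> is invariant, so the face terms cancel pointwise.\<close>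

lemma avgs_pderiv_eta_fibre:
  assumes "cell = xs @ (m, a) # ys" "m \<in> {1, 2}" "a \<in> {1, \<i>}" "k < 3" "l < 3" "z \<in> Cspace 3"
  shows "avgs cell (pderiv_dir m a (eta k l)) z = 0"
proof -
  have set: "fst ` set (xs @ (m, a) # ys) \<subseteq> {..<3}"
    unfolding assms(1)[symmetric] by auto
  have C: "C1_fun 3 (eta k l)" using assms by (intro C1_eta)
  have m: "m < 3" using assms by auto
  have per: "eta k l (y(m := y m + a)) - eta k l y = 0" if "y \<in> Cspace 3" for y
  proof -
    have "a \<in> gauss_ints" using assms(3) by auto
    then show ?thesis
      using assms(2) eta_fibre_invariant[of a 0 y k l] eta_fibre_invariant[of 0 a y k l] that assms
      by (auto simp: act_fibre)
  qed
  have "avgs cell (pderiv_dir m a (eta k l)) z =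
      avgs (xs @ ys) (\<lambda>y. eta k l (y(m := y m + a)) - eta k l y) z"
    unfolding assms(1)
    using avgs_pderiv_dir[OF set, of "eta k l" "pderiv_dir m a (eta k l)"] C1_funD[OF C] m assms by simp
  also have "\<dots> = avgs (xs @ ys) (\<lambda>y. 0) z"
    by (rule avgs_cong[where n = 3]) (use set per assms in auto)
  finally show ?thesis by (simp add: avgs_zero)
qed

text \<open>A step \<open>a\<close> in z_0 is a lattice move preceded by a translation of z_2 by
  \<open>?s y\<close>, chosen to undo the shear. The z_2-torus average absorbs that
  translation.\<close>

lemma avgs_eta_12_shift:
  assumes "a \<in> gauss_ints" "z \<in> Cspace 3"
  shows "avgs [(2, 1), (2, \<i>)] (\<lambda>y. eta 1 2 (y(0 := y 0 + a))) z = avgs [(2, 1), (2, \<i>)] (eta 1 2) z"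
proof -
  let ?s = "\<lambda>y::cvec. a * y 1 - cnj a * y 0"
  have shift: "eta 1 2 (y(0 := y 0 + a)) = eta 1 2 (y(2 := y 2 + ?s y))" if "y \<in> Cspace 3" for y
  proof -
    have "act a 0 0 (y(2 := y 2 + ?s y)) = y(0 := y 0 + a)"
      by (auto simp: act_def fun_eq_iff)
    then show ?thesis
      using eta_12_invariant[OF assms(1), of "y(2 := y 2 + ?s y)"] that by (simp add: Cspace_upd)
  qed
  have "avgs [(2, 1), (2, \<i>)] (\<lambda>y. eta 1 2 (y(0 := y 0 + a))) z =
      avgs [(2, 1), (2, \<i>)] (\<lambda>y. eta 1 2 (y(2 := y 2 + ?s y))) z"
    by (rule avgs_cong[where n = 3]) (use shift assms in auto)
  \<comment> \<open>The amount \<open>?s y\<close> involves only coordinates 0 and 1, so it is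
    constant along the two averages and can be moved to the base point.\<close>
  also have "\<dots> = avgs [(2, 1), (2, \<i>)] (eta 1 2) (z(2 := z 2 + ?s z))"
    by (simp add: avg_def add.assoc add.commute add.left_commute)
  also have "\<dots> = avgs [(2, 1), (2, \<i>)] (eta 1 2) z"
  proof (rule avgs_periodic_shift[where n = 3])
    show "continuous_on (Cspace 3) (eta 1 2)"
      by (rule C1_funD(1)[OF C1_eta]) auto
    show "eta 1 2 (y(2 := y 2 + 1)) = eta 1 2 y" if "y \<in> Cspace 3" for y
      using eta_fibre_invariant[of 0 1 y 1 2] that by (simp add: act_fibre)
    show "eta 1 2 (y(2 := y 2 + \<i>)) = eta 1 2 y" if "y \<in> Cspace 3" for y
      using eta_fibre_invariant[of 0 \<i> y 1 2] that by (simp add: act_fibre)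
  qed (use assms in auto)
  finally show ?thesis .
qed

text \<open>Opposite z_0 faces do not match pointwise; their difference vanishes only after the two
  innermost averages, whatever the outer ones do.\<close>

lemma avgs_pderiv_eta_base:
  assumes "cell = xs @ (0, a) # ys @ [(2, 1), (2, \<i>)]" "a \<in> {1, \<i>}" "z \<in> Cspace 3"
  shows "avgs cell (pderiv_dir 0 a (eta 1 2)) z = 0"
proof -
  have set: "fst ` set (xs @ (0, a) # ys @ [(2, 1), (2, \<i>)]) \<subseteq> {..<3}"
    unfolding assms(1)[symmetric] by auto
  have C: "C1_fun 3 (eta 1 2)" by (intro C1_eta) auto
  note cont = C1_funD(1)[OF C]
  have cont': "continuous_on (Cspace 3) (\<lambda>y. eta 1 2 (y(0 := y 0 + a)))"
  proof (rule continuous_on_compose2[OF cont])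
    show "continuous_on (Cspace 3) (\<lambda>y. y(0 := y 0 + a))"
      by (rule continuous_on_upd) (intro continuous_intros)+
  qed (auto intro: Cspace_upd)
  have a: "a \<in> gauss_ints" using assms(2) by auto
  have "avgs cell (pderiv_dir 0 a (eta 1 2)) z =
      avgs (xs @ ys @ [(2, 1), (2, \<i>)]) (\<lambda>y. eta 1 2 (y(0 := y 0 + a)) - eta 1 2 y) z"
    unfolding assms(1)
    using avgs_pderiv_dir[OF set, of "eta 1 2" "pderiv_dir 0 a (eta 1 2)"] C1_funD[OF C] assms by simp
  \<comment> \<open>The difference is written with the factor - 1 to fit \<open>avgs_add\<close> and
    \<open>avgs_cmult\<close>.\<close>
  also have "\<dots> = avgs (xs @ ys) (avgs [(2, 1), (2, \<i>)] (\<lambda>y. eta 1 2 (y(0 := y 0 + a)) + (- 1) * eta 1 2 y)) z"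
    by (simp add: avgs_append)
  also have "\<dots> = avgs (xs @ ys) (\<lambda>y. 0) z"
  proof (rule avgs_cong[where n = 3])
    fix y assume y: "y \<in> Cspace 3"
    have "avgs [(2, 1), (2, \<i>)] (\<lambda>y. eta 1 2 (y(0 := y 0 + a)) + (- 1) * eta 1 2 y) y =
        avgs [(2, 1), (2, \<i>)] (\<lambda>y. eta 1 2 (y(0 := y 0 + a))) y +
        avgs [(2, 1), (2, \<i>)] (\<lambda>y. (- 1) * eta 1 2 y) y"
      by (rule avgs_add[where n = 3]) (use y cont cont' in \<open>auto intro!: continuous_intros\<close>)
    then show "avgs [(2, 1), (2, \<i>)] (\<lambda>y. eta 1 2 (y(0 := y 0 + a)) + (- 1) * eta 1 2 y) y = 0"
      unfolding avgs_eta_12_shift[OF a y] avgs_cmult by simp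
  qed (use set assms in auto)
  finally show ?thesis by (simp add: avgs_zero)
qed

lemma contradiction: False
proof -
  let ?o = "\<lambda>i::nat. 0 :: complex"
  have o: "?o \<in> Cspace 3" by (simp add: Cspace_def)
  have cell: "fst ` set cell \<subseteq> {..<3}" by auto
  let ?P = "\<lambda>m a k l. pderiv_dir m a (eta k l)"
  have cont: "continuous_on (Cspace 3) (?P m a k l)" if "m < 3" "a \<in> {1, \<i>}" "k < 3" "l < 3" for m a k l
    using C1_funD(2)[OF C1_eta[OF that(3,4)] that(1,2)] .
  \<comment> \<open>The divergence with each \<open>d_zbar\<close> expanded into real derivatives,
    whence the factors 1/2 and \<i>/2; the middle term enters with a minus. Nesting to the right
    lets \<open>avgs_add\<close> split off one summand at a time.\<close>
  let ?F = "\<lambda>y. (1 / 2) * ?P 0 1 1 2 y + ((\<i> / 2) * ?P 0 \<i> 1 2 y + ((- 1 / 2) * ?P 1 1 0 2 y +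
      ((- \<i> / 2) * ?P 1 \<i> 0 2 y + ((1 / 2) * ?P 2 1 0 1 y + (\<i> / 2) * ?P 2 \<i> 0 1 y))))"
  have F: "?F y = - minor 1 2 1 2 y" if "y \<in> Cspace 3" for y
    using divergence_eta[OF that] by (simp add: d_zbar_def field_simps)
  have "Re (avgs cell ?F ?o) > 0"
  proof (rule avgs_Re_pos[OF cell _ o])
    show "continuous_on (Cspace 3) ?F"
      by (intro continuous_intros cont) auto
    show "Re (?F y) > 0" if "y \<in> Cspace 3" for y
      unfolding F[OF that] by (rule divergence_pos[OF that])
  qed
  moreover have "avgs cell ?F ?o = (1 / 2) * avgs cell (?P 0 1 1 2) ?o + ((\<i> / 2) * avgs cell (?P 0 \<i> 1 2) ?o +
      ((- 1 / 2) * avgs cell (?P 1 1 0 2) ?o + ((- \<i> / 2) * avgs cell (?P 1 \<i> 0 2) ?o +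
      ((1 / 2) * avgs cell (?P 2 1 0 1) ?o + (\<i> / 2) * avgs cell (?P 2 \<i> 0 1) ?o))))"
    by (subst avgs_add[OF cell _ _ o], (intro continuous_intros cont; simp)+,
        subst avgs_cmult, rule arg_cong2[where f = "(+)"], rule refl)+ 
      (simp only: avgs_cmult)
  moreover have "avgs cell (?P 0 1 1 2) ?o = 0"
    by (rule avgs_pderiv_eta_base[of "[]" _ "[(0, \<i>), (1, 1), (1, \<i>)]"]) (use o in auto)
  moreover have "avgs cell (?P 0 \<i> 1 2) ?o = 0"
    by (rule avgs_pderiv_eta_base[of "[(0, 1)]" _ "[(1, 1), (1, \<i>)]"]) (use o in auto)
  moreover have "avgs cell (?P 1 1 0 2) ?o = 0"
    by (rule avgs_pderiv_eta_fibre[of "[(0, 1), (0, \<i>)]" _ _ "[(1, \<i>), (2, 1), (2, \<i>)]"]) (use o in auto)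
  moreover have "avgs cell (?P 1 \<i> 0 2) ?o = 0"
    by (rule avgs_pderiv_eta_fibre[of "[(0, 1), (0, \<i>), (1, 1)]" _ _ "[(2, 1), (2, \<i>)]"]) (use o in auto)
  moreover have "avgs cell (?P 2 1 0 1) ?o = 0"
    by (rule avgs_pderiv_eta_fibre[of "[(0, 1), (0, \<i>), (1, 1), (1, \<i>)]" _ _ "[(2, \<i>)]"]) (use o in auto)
  moreover have "avgs cell (?P 2 \<i> 0 1) ?o = 0"
    by (rule avgs_pderiv_eta_fibre[of "[(0, 1), (0, \<i>), (1, 1), (1, \<i>), (2, 1)]" _ _ "[]"]) (use o in auto)
  ultimately show False by simp
qed

end

theorem theorem1p8:
  shows "\<exists>(n :: nat) (X :: manifold_point topology) (A :: manifold_point chart set).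
    compact_complex_manifold n X A \<and>
    strongly_Gauduchon_manifold n A \<and>
    \<not> balanced_manifold n A \<and>
    \<not> satisfies_del_delbar_lemma n A"
proof (intro exI conjI)
  show "\<not> balanced_manifold 3 nil_atlas"
    unfolding balanced_manifold_def
    using nil_balanced.contradiction nil_balanced.intro by blast
qed (rule compact_complex_manifold_nil strongly_Gauduchon_nil not_del_delbar_lemma_nil)+

end
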